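(* The complex Fermat quartic surface $F^2_4=(X_0^4+X_1^4+X_2^4+X_3^4=0)\subset\mathbb{P}^3_{\mathbb{C}}$ has at least $4$ pairwise non-isomorphic real forms, namely the following surfaces in $\mathbb{P}^3_{\mathbb{R}}$: - $(X_0^4+X_1^4+X_2^4+X_3^4=0)$, - $(-X_0^4+X_1^4+X_2^4+X_3^4=0)$, - $(-X_0^4-X_1^4+X_2^4+X_3^4=0)$, - $(X_0^4+X_1^4+(X_2+\sqrt{-1}\,X_3)^4+(X_2-\sqrt{-1}\,X_3)^4=0)$.
   Context: A real form of a complex algebraic variety $X$ is a real algebraic variety $X_{\mathbb{R}}$ together with a $\mathbb{C}$-isomorphism $X_{\mathbb{R}}\times_{\operatorname{Spec}\mathbb{R}}\operatorname{Spec}\mathbb{C}\cong X$. Real forms are compared up to isomorphism of $\mathbb{R}$-varieties. *)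

theory Defs
  imports "HOL-Analysis.Analysis"
begin

text \<open>
  Varieties are treated in the classical language of spaces with functions over a subfield \<open>k\<close> of
  the algebraically closed field \<open>\<complex>\<close> (here \<open>k = \<real>\<close> or \<open>k = UNIV\<close>): the points are the geometric
  points, i.e. the points with complex coordinates, while the Zariski topology, the regular functions
  and hence the morphisms are given by polynomials with coefficients in \<open>k\<close>. For \<open>k = \<real>\<close>,
  a regular function therefore takes complex values at non-real points, and complex conjugate
  points have the same open neighbourhoods (together they are one closed point of the corresponding
  \<open>\<real>\<close>-scheme).
\<close>

subsection \<open>Spaces with functions\<close>

text \<open>
  \<open>reg X U\<close> is the set of regular functions on the open set \<open>U\<close>. Functions are total in HOL;
  only the values on \<open>U\<close> matter.
\<close>

record 'p fspace =
  zar :: "'p topology"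
  reg :: "'p set \<Rightarrow> ('p \<Rightarrow> complex) set"

definition morphism :: "'p fspace \<Rightarrow> 'q fspace \<Rightarrow> ('p \<Rightarrow> 'q) \<Rightarrow> bool" where
  "morphism X Y \<phi> \<longleftrightarrow>
     continuous_map (zar X) (zar Y) \<phi> \<and>
     (\<forall>V f. openin (zar Y) V \<and> f \<in> reg Y V \<longrightarrow>
        f \<circ> \<phi> \<in> reg X {p \<in> topspace (zar X). \<phi> p \<in> V})"

definition isomorphic :: "'p fspace \<Rightarrow> 'q fspace \<Rightarrow> bool" where
  "isomorphic X Y \<longleftrightarrow>
     (\<exists>\<phi> \<psi>. morphism X Y \<phi> \<and> morphism Y X \<psi> \<and>
        (\<forall>p \<in> topspace (zar X). \<psi> (\<phi> p) = p) \<and>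
        (\<forall>q \<in> topspace (zar Y). \<phi> (\<psi> q) = q))"

definition irreducible_space :: "'p topology \<Rightarrow> bool" where
  "irreducible_space T \<longleftrightarrow>
     topspace T \<noteq> {} \<and>
     (\<forall>U V. openin T U \<and> openin T V \<and> U \<noteq> {} \<and> V \<noteq> {} \<longrightarrow> U \<inter> V \<noteq> {})"

subsection \<open>Quasi-projective varieties over a subfield of the complex numbers\<close>

text \<open>
  A point of projective space with homogeneous coordinates indexed by \<open>'n\<close> is the set of all its
  homogeneous coordinate vectors; for \<open>'n = 4\<close> the coordinates are \<open>x $ 0\<close>, ..., \<open>x $ 3\<close>.
\<close>

definition proj_point :: "complex ^ 'n \<Rightarrow> (complex ^ 'n) set" where
  "proj_point x = {c *s x | c. c \<noteq> 0}"

definition proj_space :: "(complex ^ 'n) set set" where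
  "proj_space = proj_point ` (UNIV - {0})"

text \<open>Homogeneous polynomials of degree \<open>d\<close> with coefficients in \<open>k\<close>, as functions (no information
  is lost, because \<open>\<complex>\<close> is infinite). An exponent vector is a function \<open>m\<close>.\<close>

definition hpoly :: "complex set \<Rightarrow> nat \<Rightarrow> (complex ^ 'n \<Rightarrow> complex) set" where
  "hpoly k d =
     {f. \<exists>M c. finite M \<and> (\<forall>m \<in> M. (\<Sum>i \<in> UNIV. m i) = d \<and> c m \<in> k) \<and>
           f = (\<lambda>x. \<Sum>m \<in> M. c m * (\<Prod>i \<in> UNIV. (x $ i) ^ m i))}"

definition zero_locus :: "(complex ^ 'n \<Rightarrow> complex) set \<Rightarrow> (complex ^ 'n) set set" where
  "zero_locus S = {P \<in> proj_space. \<forall>f \<in> S. \<forall>x \<in> P. f x = 0}"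

definition zariski :: "complex set \<Rightarrow> (complex ^ 'n) set topology" where
  "zariski k = topology_generated_by {proj_space - zero_locus {f} | f d. f \<in> hpoly k d}"

definition regular_fun ::
  "complex set \<Rightarrow> (complex ^ 'n) set set \<Rightarrow> (complex ^ 'n) set set \<Rightarrow>
     ((complex ^ 'n) set \<Rightarrow> complex) set" where
  "regular_fun k V U =
     {f. \<forall>P \<in> U. \<exists>W d g h. openin (subtopology (zariski k) V) W \<and> P \<in> W \<and> W \<subseteq> U \<and>
           g \<in> hpoly k d \<and> h \<in> hpoly k d \<and>
           (\<forall>Q \<in> W. \<forall>x \<in> Q. h x \<noteq> 0 \<and> f Q = g x / h x)}"

definition proj_subspace :: "complex set \<Rightarrow> (complex ^ 'n) set set \<Rightarrow> (complex ^ 'n) set fspace" where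
  "proj_subspace k V = \<lparr>zar = subtopology (zariski k) V, reg = regular_fun k V\<rparr>"

text \<open>Irreducible locally closed subspaces of projective space.\<close>

definition variety :: "complex set \<Rightarrow> (complex ^ 'n) set fspace \<Rightarrow> bool" where
  "variety k X \<longleftrightarrow>
     (\<exists>S T. S \<subseteq> (\<Union>d. hpoly k d) \<and> T \<subseteq> (\<Union>d. hpoly k d) \<and>
        X = proj_subspace k (zero_locus S - zero_locus T)) \<and>
     irreducible_space (zar X)"

definition hypersurface :: "complex set \<Rightarrow> (complex ^ 'n \<Rightarrow> complex) \<Rightarrow> (complex ^ 'n) set fspace" where
  "hypersurface k F = proj_subspace k (zero_locus {F})"

subsection \<open>Base change from the reals to the complex numbers, and real forms\<close>

text \<open>
  For an \<open>\<real>\<close>-variety \<open>X\<close>, \<open>extended_reg X U\<close> is \<open>\<O>(U) \<otimes> \<complex> = \<O>(U) \<oplus> \<i> \<O>(U)\<close>. The fibre product of \<open>X\<close>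
  with \<open>Spec \<complex>\<close> over \<open>Spec \<real>\<close> is glued from the affine varieties with coordinate rings \<open>\<O>(U) \<otimes> \<complex>\<close>,
  for \<open>U\<close> affine open in \<open>X\<close>: its complex points are the geometric points of \<open>X\<close>, its basic open
  sets are the non-vanishing loci of elements of \<open>\<O>(U) \<otimes> \<complex>\<close>, and its regular functions are locally
  fractions of such elements.
\<close>

definition extended_reg :: "'p fspace \<Rightarrow> 'p set \<Rightarrow> ('p \<Rightarrow> complex) set" where
  "extended_reg X U = {\<lambda>p. a p + \<i> * b p | a b. a \<in> reg X U \<and> b \<in> reg X U}"

definition base_change_top :: "'p fspace \<Rightarrow> 'p topology" where
  "base_change_top X =
     topology_generated_by
       {{p \<in> U. h p \<noteq> 0} | U h. openin (zar X) U \<and> h \<in> extended_reg X U}"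

definition base_change_reg :: "'p fspace \<Rightarrow> 'p set \<Rightarrow> ('p \<Rightarrow> complex) set" where
  "base_change_reg X W =
     {f. \<forall>p \<in> W. \<exists>W' U g h. openin (base_change_top X) W' \<and> p \<in> W' \<and> W' \<subseteq> W \<and>
           openin (zar X) U \<and> W' \<subseteq> U \<and> g \<in> extended_reg X U \<and> h \<in> extended_reg X U \<and>
           (\<forall>q \<in> W'. h q \<noteq> 0 \<and> f q = g q / h q)}"

definition base_change :: "'p fspace \<Rightarrow> 'p fspace" where
  "base_change X = \<lparr>zar = base_change_top X, reg = base_change_reg X\<rparr>"

definition real_form :: "(complex ^ 'm) set fspace \<Rightarrow> (complex ^ 'n) set fspace \<Rightarrow> bool" where
  "real_form Y X \<longleftrightarrow> variety \<real> Y \<and> variety UNIV X \<and> isomorphic (base_change Y) X"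

end

theory Submission
  imports Defs "HOL-Complex_Analysis.Conformal_Mappings"
begin

text \<open>
  Over \<open>\<complex>\<close> the four quartics differ by linear changes of coordinates. The Fermat quartic surface is irreducible because its open subsets
  \<open>x\<^sub>0\<^sup>4 + x\<^sub>i\<^sup>4 \<noteq> 0\<close>, which cover it, are images of the product of the irreducible curve
  \<open>a\<^sup>4 + b\<^sup>4 = 1\<close> with itself. An isomorphism over \<open>\<real>\<close> is a homeomorphism
  of the real loci, and these are empty, a sphere, a torus, and two disjoint spheres. The sphere and
  the torus are told apart by a map from the torus to the circle whose composition with a suitable
  loop is \<open>w \<mapsto> w\<^sup>2\<close>: through the simply connected sphere it would have a continuous logarithm.
\<close>

section \<open>Homogeneous polynomials\<close>

text \<open>The definitions carry only the Zariski topology on complex points, so a homeomorphism of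
  real loci is never stated as such. Its substitute: a morphism over \<open>\<real>\<close> maps
  real points to real points and lifts, near each of them, to a vector of quotients of real forms. A
  scale-invariant function of real vectors, evaluated after the morphism along a continuous family
  of real vectors, is therefore continuous. The parameter spaces are punctured linear spaces and
  their products instead of compact spheres and tori, which makes connectedness and simple
  connectedness immediate. The loop yields \<open>w\<^sup>2\<close> and not \<open>w\<close> because
  a real point fixes its vector only up to a real factor of either sign, so that only the square of
  a unit direction is well defined. Irreducibility has to be proved because \<open>variety\<close>
  demands it; the real case follows from the complex one, since real forms cut out fewer open sets.
  One locale serves both coefficient fields.\<close>

locale coeff_ring =
  fixes k :: "complex set"
  assumes one_closed: "1 \<in> k"
    and diff_closed: "a \<in> k \<Longrightarrow> b \<in> k \<Longrightarrow> a - b \<in> k"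
    and mult_closed: "a \<in> k \<Longrightarrow> b \<in> k \<Longrightarrow> a * b \<in> k"
begin

lemma zero_closed: "0 \<in> k"
  using diff_closed[OF one_closed one_closed] by simp

lemma add_closed: "a \<in> k \<Longrightarrow> b \<in> k \<Longrightarrow> a + b \<in> k"
  using diff_closed[of a "0 - b"] diff_closed[of 0 b] zero_closed by simp

lemma hpoly_monomial:
  assumes "c \<in> k"
  shows "(\<lambda>x::complex^'n. c * (\<Prod>i\<in>UNIV. x$i ^ m i)) \<in> hpoly k (sum m UNIV)"
  unfolding hpoly_def mem_Collect_eq
  by (rule exI[of _ "{m}"], rule exI[of _ "\<lambda>_. c"]) (use assms in auto)

lemma hpoly_add:
  fixes f g :: "complex^'n \<Rightarrow> complex"
  assumes "f \<in> hpoly k d" "g \<in> hpoly k d"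
  shows "(\<lambda>x. f x + g x) \<in> hpoly k d"
proof -
  obtain M a where M: "finite M" "\<And>m. m \<in> M \<Longrightarrow> sum m UNIV = d \<and> a m \<in> k"
      "f = (\<lambda>x. \<Sum>m\<in>M. a m * (\<Prod>i\<in>UNIV. x$i ^ m i))"
    using assms(1) unfolding hpoly_def by auto
  obtain N b where N: "finite N" "\<And>m. m \<in> N \<Longrightarrow> sum m UNIV = d \<and> b m \<in> k"
      "g = (\<lambda>x. \<Sum>m\<in>N. b m * (\<Prod>i\<in>UNIV. x$i ^ m i))"
    using assms(2) unfolding hpoly_def by auto
  \<comment> \<open>Both presentations are padded with zero coefficients to the common index set
    \<open>M \<union> N\<close>.\<close>
  define c where "c m = (if m \<in> M then a m else 0) + (if m \<in> N then b m else 0)" for m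
  have "f x + g x = (\<Sum>m\<in>M \<union> N. c m * (\<Prod>i\<in>UNIV. x$i ^ m i))" for x
  proof -
    have "f x = (\<Sum>m\<in>M \<union> N. (if m \<in> M then a m else 0) * (\<Prod>i\<in>UNIV. x$i ^ m i))"
      unfolding M(3) by (rule sum.mono_neutral_cong_left) (use M(1) N(1) in auto)
    moreover have "g x = (\<Sum>m\<in>M \<union> N. (if m \<in> N then b m else 0) * (\<Prod>i\<in>UNIV. x$i ^ m i))"
      unfolding N(3) by (rule sum.mono_neutral_cong_left) (use M(1) N(1) in auto)
    ultimately show ?thesis
      by (simp add: c_def distrib_right sum.distrib)
  qed
  moreover have "\<forall>m\<in>M \<union> N. sum m UNIV = d \<and> c m \<in> k"
    using M(2) N(2) by (auto simp: c_def add_closed zero_closed)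
  ultimately show ?thesis
    unfolding hpoly_def using M(1) N(1) by blast
qed

lemma hpoly_zero: "(\<lambda>x::complex^'n. 0) \<in> hpoly k d"
  unfolding hpoly_def mem_Collect_eq by (rule exI[of _ "{}"]) auto

lemma hpoly_sum:
  "(\<And>i. i \<in> I \<Longrightarrow> f i \<in> hpoly k d) \<Longrightarrow> (\<lambda>x::complex^'n. \<Sum>i\<in>I. f i x) \<in> hpoly k d"
  by (induction I rule: infinite_finite_induct) (auto intro: hpoly_zero hpoly_add)

lemma hpoly_mult:
  fixes f g :: "complex^'n \<Rightarrow> complex"
  assumes "f \<in> hpoly k d" "g \<in> hpoly k e"
  shows "(\<lambda>x. f x * g x) \<in> hpoly k (d + e)"
proof -
  obtain M a where M: "finite M" "\<And>m. m \<in> M \<Longrightarrow> sum m UNIV = d \<and> a m \<in> k"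
      "f = (\<lambda>x. \<Sum>m\<in>M. a m * (\<Prod>i\<in>UNIV. x$i ^ m i))"
    using assms(1) unfolding hpoly_def by auto
  obtain N b where N: "finite N" "\<And>m. m \<in> N \<Longrightarrow> sum m UNIV = e \<and> b m \<in> k"
      "g = (\<lambda>x. \<Sum>m\<in>N. b m * (\<Prod>i\<in>UNIV. x$i ^ m i))"
    using assms(2) unfolding hpoly_def by auto
  have "(\<lambda>x. (a m * b n) * (\<Prod>i\<in>UNIV. x$i ^ (m i + n i))) \<in> hpoly k (d + e)"
    if "m \<in> M" "n \<in> N" for m n
    using hpoly_monomial[of "a m * b n" "\<lambda>i. m i + n i"] M(2) N(2) that
    by (simp add: mult_closed sum.distrib)
  then have "(\<lambda>x. \<Sum>m\<in>M. \<Sum>n\<in>N. (a m * b n) * (\<Prod>i\<in>UNIV. x$i ^ (m i + n i))) \<in> hpoly k (d + e)"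
    by (intro hpoly_sum) auto
  moreover have "(\<lambda>x. f x * g x) =
      (\<lambda>x. \<Sum>m\<in>M. \<Sum>n\<in>N. (a m * b n) * (\<Prod>i\<in>UNIV. x$i ^ (m i + n i)))"
    by (simp add: M(3) N(3) sum_product power_add prod.distrib mult_ac)
  ultimately show ?thesis by simp
qed

lemma hpoly_const: "c \<in> k \<Longrightarrow> (\<lambda>x::complex^'n. c) \<in> hpoly k 0"
  using hpoly_monomial[of c "\<lambda>_. 0"] by simp

lemma hpoly_scale: "c \<in> k \<Longrightarrow> f \<in> hpoly k d \<Longrightarrow> (\<lambda>x::complex^'n. c * f x) \<in> hpoly k d"
  using hpoly_mult[OF hpoly_const, of c f d] by simp

lemma hpoly_diff:
  "f \<in> hpoly k d \<Longrightarrow> g \<in> hpoly k d \<Longrightarrow> (\<lambda>x::complex^'n. f x - g x) \<in> hpoly k d"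
  using hpoly_add[of f d "\<lambda>x. (0 - 1) * g x"] hpoly_scale[of "0 - 1" g d]
    diff_closed[OF zero_closed one_closed] by simp

lemma hpoly_uminus:
  "f \<in> hpoly k d \<Longrightarrow> (\<lambda>x::complex^'n. - f x) \<in> hpoly k d"
  using hpoly_diff[OF hpoly_zero] by simp

lemma hpoly_coord: "(\<lambda>x::complex^'n. x$i) \<in> hpoly k 1"
proof -
  have "(\<Prod>j\<in>UNIV. x$j ^ (if j = i then 1 else 0)) = x$i" for x :: "complex^'n"
  proof -
    have "(\<Prod>j\<in>UNIV. x$j ^ (if j = i then 1 else 0)) = (\<Prod>j\<in>UNIV. if j = i then x$j else 1)"
      by (rule prod.cong) auto
    then show ?thesis by simp
  qed
  then show ?thesis
    using hpoly_monomial[OF one_closed, of "\<lambda>j. if j = i then 1 else 0"] by simp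
qed

lemma hpoly_power:
  "f \<in> hpoly k d \<Longrightarrow> (\<lambda>x::complex^'n. f x ^ e) \<in> hpoly k (e * d)"
  by (induction e) (auto intro: hpoly_const one_closed hpoly_mult)

lemma hpoly_coord_power: "(\<lambda>x::complex^'n. x$i ^ d) \<in> hpoly k d"
  using hpoly_power[OF hpoly_coord, of i d] by simp

lemma hpoly_prod:
  "(\<And>i. i \<in> I \<Longrightarrow> f i \<in> hpoly k (d i)) \<Longrightarrow>
     (\<lambda>x::complex^'n. \<Prod>i\<in>I. f i x) \<in> hpoly k (\<Sum>i\<in>I. d i)"
  by (induction I rule: infinite_finite_induct) (auto intro: hpoly_const one_closed hpoly_mult)

text \<open>Requiring the coordinates of \<open>L\<close> to be forms of degree 1 over
  \<open>k\<close> makes \<open>L\<close> linear with matrix entries in \<open>k\<close>.\<close>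

lemma hpoly_compose_linear:
  fixes f :: "complex^'m \<Rightarrow> complex" and L :: "complex^'n \<Rightarrow> complex^'m"
  assumes "f \<in> hpoly k d" and L: "\<And>i. (\<lambda>x. L x $ i) \<in> hpoly k 1"
  shows "(\<lambda>x. f (L x)) \<in> hpoly k d"
proof -
  obtain M a where M: "finite M" "\<And>m. m \<in> M \<Longrightarrow> sum m UNIV = d \<and> a m \<in> k"
      "f = (\<lambda>x. \<Sum>m\<in>M. a m * (\<Prod>i\<in>UNIV. x$i ^ m i))"
    using assms(1) unfolding hpoly_def by auto
  have "(\<lambda>x. a m * (\<Prod>i\<in>UNIV. L x $ i ^ m i)) \<in> hpoly k d" if "m \<in> M" for m
    using hpoly_prod[of UNIV "\<lambda>i x. L x $ i ^ m i" m] hpoly_power[OF L] M(2)[OF that]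
    by (auto intro: hpoly_scale)
  then show ?thesis
    unfolding M(3) by (intro hpoly_sum)
qed

end

interpretation real_coeff: coeff_ring \<real>
  by unfold_locales auto

interpretation complex_coeff: coeff_ring UNIV
  by unfold_locales auto

lemma hpoly_homogeneous:
  assumes "f \<in> hpoly k d"
  shows "f (c *s x) = c ^ d * f x"
  using assms unfolding hpoly_def
  by (auto simp: power_mult_distrib prod.distrib power_sum[symmetric] sum_distrib_left mult_ac
      intro!: sum.cong)

lemma continuous_on_hpoly: "f \<in> hpoly k d \<Longrightarrow> continuous_on S f"
  unfolding hpoly_def by (auto intro!: continuous_intros)

lemma hpoly_real_value:
  assumes "f \<in> hpoly \<real> d" "\<And>i. x$i \<in> \<real>"
  shows "f x \<in> \<real>"
  using assms unfolding hpoly_def by auto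

lemma hpoly_real_imp_complex: "f \<in> hpoly \<real> d \<Longrightarrow> f \<in> hpoly UNIV d"
  unfolding hpoly_def by blast

text \<open>It is the coefficients that are split into real and imaginary parts. The functions
  \<open>a\<close> and \<open>b\<close> still take complex values at non-real points and are not
  \<open>Re f\<close> and \<open>Im f\<close>.\<close>

lemma hpoly_complex_split:
  fixes f :: "complex^'n \<Rightarrow> complex"
  assumes "f \<in> hpoly UNIV d"
  obtains a b where "a \<in> hpoly \<real> d" "b \<in> hpoly \<real> d" "f = (\<lambda>x. a x + \<i> * b x)"
proof -
  obtain M c where M: "finite M" "\<And>m. m \<in> M \<Longrightarrow> sum m UNIV = d"
      "f = (\<lambda>x. \<Sum>m\<in>M. c m * (\<Prod>i\<in>UNIV. x$i ^ m i))"
    using assms unfolding hpoly_def by auto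
  let ?p = "\<lambda>r x. \<Sum>m\<in>M. complex_of_real (r (c m)) * (\<Prod>i\<in>UNIV. x$i ^ m i)"
  have "?p r \<in> hpoly \<real> d" for r
    unfolding hpoly_def mem_Collect_eq using M
    by (intro exI[of _ M] exI[of _ "\<lambda>m. complex_of_real (r (c m))"]) auto
  moreover have "f = (\<lambda>x. ?p Re x + \<i> * ?p Im x)"
  proof
    fix x
    have "?p Re x + \<i> * ?p Im x =
        (\<Sum>m\<in>M. (complex_of_real (Re (c m)) + \<i> * complex_of_real (Im (c m))) * (\<Prod>i\<in>UNIV. x$i ^ m i))"
      by (simp add: sum_distrib_left sum.distrib ring_distribs mult.assoc)
    moreover have "complex_of_real (Re z) + \<i> * complex_of_real (Im z) = z" for z
      by (simp add: complex_eq_iff)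
    ultimately show "f x = ?p Re x + \<i> * ?p Im x"
      by (simp add: M(3))
  qed
  ultimately show ?thesis using that by blast
qed

section \<open>The Zariski topology and regular functions\<close>

lemma proj_spaceE:
  assumes "P \<in> proj_space"
  obtains x where "x \<noteq> 0" "P = proj_point x"
  using assms unfolding proj_space_def by auto

lemma subset_proj_spaceE:
  assumes "P \<in> U" "U \<subseteq> proj_space"
  obtains x where "x \<noteq> 0" "P = proj_point x"
  using assms by (meson proj_spaceE subsetD)

lemma proj_point_in_proj_space [simp]: "x \<noteq> 0 \<Longrightarrow> proj_point x \<in> proj_space"
  unfolding proj_space_def by auto

lemma mem_proj_point_self [simp]: "x \<in> proj_point x"
  unfolding proj_point_def by (auto intro!: exI[of _ 1])

lemma mem_proj_pointE:
  assumes "y \<in> proj_point x"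
  obtains c where "c \<noteq> 0" "y = c *s x"
  using assms unfolding proj_point_def by auto

lemma proj_point_scale:
  assumes "c \<noteq> 0"
  shows "proj_point (c *s x) = proj_point x"
proof -
  have "\<exists>d'. d *s x = d' *s (c *s x) \<and> d' \<noteq> 0" if "d \<noteq> 0" for d
    using that assms by (intro exI[of _ "d / c"]) simp
  moreover have "\<exists>d'. d *s (c *s x) = d' *s x \<and> d' \<noteq> 0" if "d \<noteq> 0" for d
    using that assms by (intro exI[of _ "d * c"]) simp
  ultimately show ?thesis
    unfolding proj_point_def by auto
qed

lemma proj_point_eqE:
  assumes "proj_point x = proj_point y"
  obtains c where "c \<noteq> 0" "x = c *s y"
  using assms mem_proj_point_self[of x] by (auto elim: mem_proj_pointE)

lemma zero_locus_subset: "zero_locus S \<subseteq> proj_space"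
  unfolding zero_locus_def by auto

lemma proj_point_in_zero_locus:
  assumes "f \<in> hpoly k d" "x \<noteq> 0"
  shows "proj_point x \<in> zero_locus {f} \<longleftrightarrow> f x = 0"
  using assms hpoly_homogeneous[OF assms(1)]
  by (auto simp: zero_locus_def elim: mem_proj_pointE)

context coeff_ring
begin

text \<open>The generating sets are closed under intersection because a product of forms is a form,
  so one nonvanishing form suffices around each point. Speaking of vectors instead of classes makes
  later changes of coordinates plain substitutions.\<close>

lemma openin_zariski_iff:
  fixes U :: "(complex^'n) set set"
  shows "openin (zariski k) U \<longleftrightarrow> U \<subseteq> proj_space \<and>
    (\<forall>x. x \<noteq> 0 \<and> proj_point x \<in> U \<longrightarrow>
      (\<exists>f d. f \<in> hpoly k d \<and> f x \<noteq> 0 \<and> (\<forall>y. y \<noteq> 0 \<and> f y \<noteq> 0 \<longrightarrow> proj_point y \<in> U)))"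
    (is "_ \<longleftrightarrow> ?R U")
proof
  let ?B = "{proj_space - zero_locus {f} | f d. f \<in> hpoly k d} :: (complex^'n) set set set"
  assume "openin (zariski k) U"
  then have "generate_topology_on ?B U"
    unfolding zariski_def openin_topology_generated_by_iff .
  then show "?R U"
  proof induction
    case Empty
    then show ?case by simp
  next
    case (Int U V)
    show ?case
    proof (intro conjI allI impI)
      show "U \<inter> V \<subseteq> proj_space" using Int by auto
      fix x :: "complex^'n"
      assume x: "x \<noteq> 0 \<and> proj_point x \<in> U \<inter> V"
      obtain f d where f: "f \<in> hpoly k d" "f x \<noteq> 0" "\<And>y. y \<noteq> 0 \<Longrightarrow> f y \<noteq> 0 \<Longrightarrow> proj_point y \<in> U"
        using Int.IH(1) x by blast
      obtain g e where g: "g \<in> hpoly k e" "g x \<noteq> 0" "\<And>y. y \<noteq> 0 \<Longrightarrow> g y \<noteq> 0 \<Longrightarrow> proj_point y \<in> V"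
        using Int.IH(2) x by blast
      show "\<exists>f d. f \<in> hpoly k d \<and> f x \<noteq> 0 \<and> (\<forall>y. y \<noteq> 0 \<and> f y \<noteq> 0 \<longrightarrow> proj_point y \<in> U \<inter> V)"
        by (intro exI[of _ "\<lambda>x. f x * g x"] exI[of _ "d + e"] conjI hpoly_mult f(1) g(1))
          (use f g in auto)
    qed
  next
    case (UN K)
    show ?case
    proof (intro conjI allI impI)
      show "\<Union>K \<subseteq> proj_space" using UN by blast
      fix x :: "complex^'n"
      assume "x \<noteq> 0 \<and> proj_point x \<in> \<Union>K"
      then obtain U where "U \<in> K" "x \<noteq> 0" "proj_point x \<in> U" by auto
      then obtain f d where "f \<in> hpoly k d" "f x \<noteq> 0" "\<forall>y. y \<noteq> 0 \<and> f y \<noteq> 0 \<longrightarrow> proj_point y \<in> U"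
        using UN.IH by blast
      then show "\<exists>f d. f \<in> hpoly k d \<and> f x \<noteq> 0 \<and> (\<forall>y. y \<noteq> 0 \<and> f y \<noteq> 0 \<longrightarrow> proj_point y \<in> \<Union>K)"
        using \<open>U \<in> K\<close> by blast
    qed
  next
    case (Basis s)
    then obtain f d where f: "f \<in> hpoly k d" "s = proj_space - zero_locus {f}" by auto
    then show ?case
      by (auto simp: proj_point_in_zero_locus[OF f(1)])
  qed
next
  assume R: "?R U"
  have "\<exists>T. openin (zariski k) T \<and> P \<in> T \<and> T \<subseteq> U" if "P \<in> U" for P
  proof -
    obtain x where x: "x \<noteq> 0" "P = proj_point x"
      using subset_proj_spaceE[OF \<open>P \<in> U\<close> R[THEN conjunct1]] by metis
    then obtain f d where f: "f \<in> hpoly k d" "f x \<noteq> 0" "\<forall>y. y \<noteq> 0 \<and> f y \<noteq> 0 \<longrightarrow> proj_point y \<in> U"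
      using R \<open>P \<in> U\<close> by blast
    have "openin (zariski k) (proj_space - zero_locus {f})"
      unfolding zariski_def by (rule topology_generated_by_Basis) (use f in auto)
    moreover have "P \<in> proj_space - zero_locus {f}"
      using x f by (simp add: proj_point_in_zero_locus[OF f(1)])
    moreover have "proj_space - zero_locus {f} \<subseteq> U"
    proof
      fix Q assume Q: "Q \<in> proj_space - zero_locus {f}"
      then obtain y where "y \<noteq> 0" "Q = proj_point y"
        by (auto elim: proj_spaceE)
      then show "Q \<in> U"
        using Q f(3) by (simp add: proj_point_in_zero_locus[OF f(1)])
    qed
    ultimately show ?thesis by blast
  qed
  then show "openin (zariski k) U"
    by (subst openin_subopen) blast
qed

end

context coeff_ring
begin

lemma topspace_zariski [simp]: "topspace (zariski k) = (proj_space :: (complex^'n) set set)"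
proof
  show "topspace (zariski k) \<subseteq> (proj_space :: (complex^'n) set set)"
    using openin_topspace[of "zariski k :: (complex^'n) set topology"] openin_zariski_iff by blast
  have "openin (zariski k) (proj_space :: (complex^'n) set set)"
    unfolding openin_zariski_iff
    by (auto intro!: exI[of _ "\<lambda>x. 1"] exI[of _ 0] hpoly_const one_closed)
  then show "(proj_space :: (complex^'n) set set) \<subseteq> topspace (zariski k)"
    by (rule openin_subset)
qed

lemma topspace_subzariski [simp]:
  "V \<subseteq> proj_space \<Longrightarrow> topspace (subtopology (zariski k) V) = (V :: (complex^'n) set set)"
  by auto

lemma openin_subzariski_iff:
  fixes V :: "(complex^'n) set set"
  assumes "V \<subseteq> proj_space"
  shows "openin (subtopology (zariski k) V) U \<longleftrightarrow> U \<subseteq> V \<and>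
    (\<forall>x. x \<noteq> 0 \<and> proj_point x \<in> U \<longrightarrow>
      (\<exists>f d. f \<in> hpoly k d \<and> f x \<noteq> 0 \<and>
        (\<forall>y. y \<noteq> 0 \<and> f y \<noteq> 0 \<and> proj_point y \<in> V \<longrightarrow> proj_point y \<in> U)))"
    (is "_ \<longleftrightarrow> ?R")
proof
  assume "openin (subtopology (zariski k) V) U"
  then show ?R
    by (force simp: openin_subtopology openin_zariski_iff)
next
  assume R: ?R
  \<comment> \<open>\<open>T\<close> is the largest open set of projective space whose trace on
    \<open>V\<close> lies in \<open>U\<close>: the union of all nonvanishing loci with that
    property.\<close>
  define T where "T = {P. \<exists>y f d. P = proj_point y \<and> y \<noteq> 0 \<and> f \<in> hpoly k d \<and> f y \<noteq> 0 \<and>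
    (\<forall>z. z \<noteq> 0 \<and> f z \<noteq> 0 \<and> proj_point z \<in> V \<longrightarrow> proj_point z \<in> U)}"
  have "openin (zariski k) T"
    unfolding openin_zariski_iff
  proof (intro conjI allI impI)
    show "T \<subseteq> proj_space" by (auto simp: T_def)
    fix x :: "complex^'n"
    assume x: "x \<noteq> 0 \<and> proj_point x \<in> T"
    then obtain y f d where y: "proj_point x = proj_point y" "f \<in> hpoly k d" "f y \<noteq> 0"
      "\<forall>z. z \<noteq> 0 \<and> f z \<noteq> 0 \<and> proj_point z \<in> V \<longrightarrow> proj_point z \<in> U"
      unfolding T_def by blast
    then have "f x \<noteq> 0"
      using hpoly_homogeneous[OF y(2)] by (metis proj_point_eqE mult_eq_0_iff power_not_zero)
    then show "\<exists>f d. f \<in> hpoly k d \<and> f x \<noteq> 0 \<and> (\<forall>y. y \<noteq> 0 \<and> f y \<noteq> 0 \<longrightarrow> proj_point y \<in> T)"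
      using y unfolding T_def by blast
  qed
  moreover have "U = T \<inter> V"
  proof (intro set_eqI iffI)
    fix P assume P: "P \<in> U"
    then obtain x where "x \<noteq> 0" "P = proj_point x"
      using P R[THEN conjunct1] assms by (meson subset_proj_spaceE subset_trans)
    then show "P \<in> T \<inter> V"
      using R P unfolding T_def by blast
  qed (auto simp: T_def)
  ultimately show "openin (subtopology (zariski k) V) U"
    by (auto simp: openin_subtopology)
qed

lemma openin_subzariski_nonvanishing:
  fixes V :: "(complex^'n) set set"
  assumes "V \<subseteq> proj_space" "f \<in> hpoly k d"
  shows "openin (subtopology (zariski k) V) (V - zero_locus {f})"
  using assms by (auto simp: openin_subzariski_iff proj_point_in_zero_locus[OF assms(2)])

lemma openin_subzariski_subset:
  "V \<subseteq> proj_space \<Longrightarrow> openin (subtopology (zariski k) V) U \<Longrightarrow> U \<subseteq> (V :: (complex^'n) set set)"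
  using openin_subset by fastforce

lemma openin_subzariskiE:
  fixes V :: "(complex^'n) set set"
  assumes "V \<subseteq> proj_space" "openin (subtopology (zariski k) V) U" "x \<noteq> 0" "proj_point x \<in> U"
  obtains f d where "f \<in> hpoly k d" "f x \<noteq> 0"
    "\<And>y. y \<noteq> 0 \<Longrightarrow> f y \<noteq> 0 \<Longrightarrow> proj_point y \<in> V \<Longrightarrow> proj_point y \<in> U"
  using assms(2)[unfolded openin_subzariski_iff[OF assms(1)], THEN conjunct2, rule_format, of x]
    assms(3,4) by metis

text \<open>The denominator itself may serve as the witness for the neighbourhood, because
  \<open>g / h = g w / (h w)\<close> where \<open>w\<close> does not vanish.\<close>

lemma regular_fun_iff:
  fixes V :: "(complex^'n) set set"
  assumes "V \<subseteq> proj_space"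
  shows "f \<in> regular_fun k V U \<longleftrightarrow> U \<subseteq> V \<and>
    (\<forall>x. x \<noteq> 0 \<and> proj_point x \<in> U \<longrightarrow>
      (\<exists>d g h. g \<in> hpoly k d \<and> h \<in> hpoly k d \<and> h x \<noteq> 0 \<and>
        (\<forall>y. y \<noteq> 0 \<and> h y \<noteq> 0 \<and> proj_point y \<in> V \<longrightarrow>
          proj_point y \<in> U \<and> f (proj_point y) = g y / h y)))"
    (is "_ \<longleftrightarrow> ?R")
proof
  assume f: "f \<in> regular_fun k V U"
  show ?R
  proof (intro conjI allI impI)
    show "U \<subseteq> V"
    proof
      fix P assume "P \<in> U"
      then show "P \<in> V"
        using f openin_subset unfolding regular_fun_def by fastforce
    qed
    fix x :: "complex^'n"
    assume x: "x \<noteq> 0 \<and> proj_point x \<in> U"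
    obtain W d g h where W: "openin (subtopology (zariski k) V) W" "proj_point x \<in> W" "W \<subseteq> U"
      and gh: "g \<in> hpoly k d" "h \<in> hpoly k d"
        "\<forall>Q\<in>W. \<forall>x\<in>Q. h x \<noteq> 0 \<and> f Q = g x / h x"
      using f[unfolded regular_fun_def mem_Collect_eq, THEN bspec, OF x[THEN conjunct2]]
      by (elim exE conjE) (rule that)
    obtain w e where w: "w \<in> hpoly k e" "w x \<noteq> 0"
      "\<And>y. y \<noteq> 0 \<Longrightarrow> w y \<noteq> 0 \<Longrightarrow> proj_point y \<in> V \<Longrightarrow> proj_point y \<in> W"
      by (rule openin_subzariskiE[OF assms W(1) x[THEN conjunct1] W(2)]) (rule that)
    show "\<exists>d g h. g \<in> hpoly k d \<and> h \<in> hpoly k d \<and> h x \<noteq> 0 \<and>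
        (\<forall>y. y \<noteq> 0 \<and> h y \<noteq> 0 \<and> proj_point y \<in> V \<longrightarrow>
          proj_point y \<in> U \<and> f (proj_point y) = g y / h y)"
      by (intro exI[of _ "d + e"] exI[of _ "\<lambda>x. g x * w x"] exI[of _ "\<lambda>x. h x * w x"]
          conjI hpoly_mult gh w(1))
        (use W gh(3) w(2,3) in auto)
  qed
next
  assume R: ?R
  show "f \<in> regular_fun k V U"
    unfolding regular_fun_def mem_Collect_eq
  proof
    fix P assume P: "P \<in> U"
    then obtain x where x: "x \<noteq> 0" "P = proj_point x"
      using P R[THEN conjunct1] assms by (meson subset_proj_spaceE subset_trans)
    then obtain d g h where gh: "g \<in> hpoly k d" "h \<in> hpoly k d" "h x \<noteq> 0"
      "\<And>y. y \<noteq> 0 \<Longrightarrow> h y \<noteq> 0 \<Longrightarrow> proj_point y \<in> V \<Longrightarrow>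
          proj_point y \<in> U \<and> f (proj_point y) = g y / h y"
      using R[THEN conjunct2, rule_format, of x] P by metis
    have "h y \<noteq> 0 \<and> f Q = g y / h y" if Q: "Q \<in> V - zero_locus {h}" and y: "y \<in> Q" for Q y
    proof -
      obtain z where z: "z \<noteq> 0" "Q = proj_point z"
        using Q assms by (meson DiffD1 subset_proj_spaceE)
      then obtain c where "c \<noteq> 0" "y = c *s z"
        using y by (blast elim: mem_proj_pointE)
      then have "y \<noteq> 0" "Q = proj_point y"
        using z by (auto simp: proj_point_scale)
      then show ?thesis
        using gh(4)[of y] Q by (auto simp: proj_point_in_zero_locus[OF gh(2)])
    qed
    moreover have "V - zero_locus {h} \<subseteq> U"
    proof
      fix Q assume Q: "Q \<in> V - zero_locus {h}"
      then obtain y where "y \<noteq> 0" "Q = proj_point y"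
        using assms by (meson DiffD1 subset_proj_spaceE)
      then show "Q \<in> U"
        using Q gh(4)[of y] by (simp add: proj_point_in_zero_locus[OF gh(2)])
    qed
    moreover have "P \<in> V - zero_locus {h}"
      using P x gh(3) R by (auto simp: proj_point_in_zero_locus[OF gh(2)])
    ultimately show "\<exists>W d g h. openin (subtopology (zariski k) V) W \<and> P \<in> W \<and> W \<subseteq> U \<and>
           g \<in> hpoly k d \<and> h \<in> hpoly k d \<and> (\<forall>Q\<in>W. \<forall>x\<in>Q. h x \<noteq> 0 \<and> f Q = g x / h x)"
      using openin_subzariski_nonvanishing[OF assms gh(2)] gh(1,2) by blast
  qed
qed

lemma regular_fun_subset:
  "V \<subseteq> proj_space \<Longrightarrow> f \<in> regular_fun k V U \<Longrightarrow> U \<subseteq> (V :: (complex^'n) set set)"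
  unfolding regular_fun_iff by (rule conjunct1)

lemma regular_funE:
  fixes V :: "(complex^'n) set set"
  assumes "V \<subseteq> proj_space" "f \<in> regular_fun k V U" "x \<noteq> 0" "proj_point x \<in> U"
  obtains d g h where "g \<in> hpoly k d" "h \<in> hpoly k d" "h x \<noteq> 0"
    "\<And>y. y \<noteq> 0 \<Longrightarrow> h y \<noteq> 0 \<Longrightarrow> proj_point y \<in> V \<Longrightarrow>
        proj_point y \<in> U \<and> f (proj_point y) = g y / h y"
  using assms(2)[unfolded regular_fun_iff[OF assms(1)], THEN conjunct2, rule_format, of x]
    assms(3,4) by metis

lemma regular_funI:
  fixes V :: "(complex^'n) set set"
  assumes "V \<subseteq> proj_space" "U \<subseteq> V"
    "\<And>x. x \<noteq> 0 \<Longrightarrow> proj_point x \<in> U \<Longrightarrow>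
      \<exists>d g h. g \<in> hpoly k d \<and> h \<in> hpoly k d \<and> h x \<noteq> 0 \<and>
        (\<forall>y. y \<noteq> 0 \<and> h y \<noteq> 0 \<and> proj_point y \<in> V \<longrightarrow>
          proj_point y \<in> U \<and> f (proj_point y) = g y / h y)"
  shows "f \<in> regular_fun k V U"
  unfolding regular_fun_iff[OF assms(1)] by (rule conjI[OF assms(2)]) (use assms(3) in auto)

end

text \<open>The rational function \<open>g / h\<close> on projective points. Any representative may
  be chosen, since numerator and denominator of equal degree scale alike.\<close>

definition hquot :: "(complex^'n \<Rightarrow> complex) \<Rightarrow> (complex^'n \<Rightarrow> complex) \<Rightarrow> (complex^'n) set \<Rightarrow> complex"
  where "hquot g h P = (let x = SOME x. x \<in> P in g x / h x)"

lemma hquot_proj_point: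
  assumes "g \<in> hpoly k d" "h \<in> hpoly k d"
  shows "hquot g h (proj_point x) = g x / h x"
proof -
  have "(SOME y. y \<in> proj_point x) \<in> proj_point x"
    by (rule someI) (rule mem_proj_point_self)
  then obtain c where "c \<noteq> 0" "(SOME y. y \<in> proj_point x) = c *s x"
    by (blast elim: mem_proj_pointE)
  then show ?thesis
    by (simp add: hquot_def Let_def hpoly_homogeneous[OF assms(1)] hpoly_homogeneous[OF assms(2)])
qed

lemma (in coeff_ring) hquot_regular:
  assumes "V \<subseteq> proj_space" "g \<in> hpoly k d" "h \<in> hpoly k d"
  shows "hquot g h \<in> regular_fun k V (V - zero_locus {h})"
proof (rule regular_funI[OF assms(1)])
  fix x
  assume "x \<noteq> 0" "proj_point x \<in> V - zero_locus {h}"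
  then show "\<exists>d g' h'. g' \<in> hpoly k d \<and> h' \<in> hpoly k d \<and> h' x \<noteq> 0 \<and>
      (\<forall>y. y \<noteq> 0 \<and> h' y \<noteq> 0 \<and> proj_point y \<in> V \<longrightarrow>
        proj_point y \<in> V - zero_locus {h} \<and> hquot g h (proj_point y) = g' y / h' y)"
    using assms by (intro exI[of _ d] exI[of _ g] exI[of _ h])
      (simp add: hquot_proj_point[OF assms(2,3)] proj_point_in_zero_locus[OF assms(3)])
qed auto

section \<open>Base change\<close>

text \<open>Two real fractions with denominators \<open>h\<close> and \<open>h'\<close> are put over
  \<open>h * h'\<close>; only the numerator acquires the coefficient \<open>\<i>\<close>.\<close>

lemma extended_reg_regular:
  fixes V :: "(complex^'n) set set"
  assumes V: "V \<subseteq> proj_space" and f: "f \<in> extended_reg (proj_subspace \<real> V) U"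
  shows "f \<in> regular_fun UNIV V U"
proof -
  obtain a b where ab: "a \<in> regular_fun \<real> V U" "b \<in> regular_fun \<real> V U" "f = (\<lambda>p. a p + \<i> * b p)"
    using f unfolding extended_reg_def proj_subspace_def by auto
  show ?thesis
  proof (rule complex_coeff.regular_funI[OF V])
    show "U \<subseteq> V" by (rule real_coeff.regular_fun_subset[OF V ab(1)])
    fix x :: "complex^'n"
    assume x: "x \<noteq> 0" "proj_point x \<in> U"
    obtain d g h where 1: "g \<in> hpoly \<real> d" "h \<in> hpoly \<real> d" "h x \<noteq> 0"
      "\<And>y. y \<noteq> 0 \<Longrightarrow> h y \<noteq> 0 \<Longrightarrow> proj_point y \<in> V \<Longrightarrow>
          proj_point y \<in> U \<and> a (proj_point y) = g y / h y"
      by (rule real_coeff.regular_funE[OF V ab(1) x]) (rule that)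
    obtain d' g' h' where 2: "g' \<in> hpoly \<real> d'" "h' \<in> hpoly \<real> d'" "h' x \<noteq> 0"
      "\<And>y. y \<noteq> 0 \<Longrightarrow> h' y \<noteq> 0 \<Longrightarrow> proj_point y \<in> V \<Longrightarrow>
          proj_point y \<in> U \<and> b (proj_point y) = g' y / h' y"
      by (rule real_coeff.regular_funE[OF V ab(2) x]) (rule that)
    note hp = 1(1,2)[THEN hpoly_real_imp_complex] 2(1,2)[THEN hpoly_real_imp_complex]
    have "(\<lambda>x. g x * h' x + \<i> * (h x * g' x)) \<in> hpoly UNIV (d + d')"
      by (intro complex_coeff.hpoly_add complex_coeff.hpoly_scale complex_coeff.hpoly_mult hp) auto
    moreover have "(\<lambda>x. h x * h' x) \<in> hpoly UNIV (d + d')"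
      by (intro complex_coeff.hpoly_mult hp)
    ultimately show "\<exists>d g h. g \<in> hpoly UNIV d \<and> h \<in> hpoly UNIV d \<and> h x \<noteq> 0 \<and>
        (\<forall>y. y \<noteq> 0 \<and> h y \<noteq> 0 \<and> proj_point y \<in> V \<longrightarrow>
          proj_point y \<in> U \<and> f (proj_point y) = g y / h y)"
      using 1(3,4) 2(3,4)
      by (intro exI[of _ "d + d'"] exI[of _ "\<lambda>x. g x * h' x + \<i> * (h x * g' x)"]
          exI[of _ "\<lambda>x. h x * h' x"] conjI) (auto simp: ab(3) field_simps)
  qed
qed

text \<open>This makes the generators of \<open>base_change_top\<close> Zariski open over
  \<open>\<complex>\<close>. Locally the set is where both numerator and denominator are nonzero,
  hence the form \<open>g * h\<close>.\<close>

lemma openin_regular_nonzero: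
  fixes V :: "(complex^'n) set set"
  assumes V: "V \<subseteq> proj_space" and f: "f \<in> regular_fun UNIV V U"
  shows "openin (subtopology (zariski UNIV) V) {P \<in> U. f P \<noteq> 0}"
  unfolding complex_coeff.openin_subzariski_iff[OF V]
proof (intro conjI allI impI)
  show "{P \<in> U. f P \<noteq> 0} \<subseteq> V" using complex_coeff.regular_fun_subset[OF V f] by blast
  fix x :: "complex^'n"
  assume x: "x \<noteq> 0 \<and> proj_point x \<in> {P \<in> U. f P \<noteq> 0}"
  then obtain d g h where gh: "g \<in> hpoly UNIV d" "h \<in> hpoly UNIV d" "h x \<noteq> 0"
    "\<And>y. y \<noteq> 0 \<Longrightarrow> h y \<noteq> 0 \<Longrightarrow> proj_point y \<in> V \<Longrightarrow>
        proj_point y \<in> U \<and> f (proj_point y) = g y / h y"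
    using x by (auto elim: complex_coeff.regular_funE[OF V f, of x])
  have "g x \<noteq> 0"
    using gh(3) gh(4)[of x] x complex_coeff.regular_fun_subset[OF V f] by auto
  then show "\<exists>w d. w \<in> hpoly UNIV d \<and> w x \<noteq> 0 \<and>
        (\<forall>y. y \<noteq> 0 \<and> w y \<noteq> 0 \<and> proj_point y \<in> V \<longrightarrow> proj_point y \<in> {P \<in> U. f P \<noteq> 0})"
    using gh by (intro exI[of _ "\<lambda>x. g x * h x"] exI[of _ "d + d"]) (auto intro: complex_coeff.hpoly_mult)
qed

text \<open>Dividing by a power of a coordinate turns complex homogeneous polynomials into elements of
  \<open>\<O>(U) \<otimes> \<complex>\<close>.\<close>

lemma hquot_extended_reg:
  fixes V :: "(complex^'n) set set"
  assumes V: "V \<subseteq> proj_space" and f: "f \<in> hpoly UNIV d"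
  shows "\<exists>r \<in> extended_reg (proj_subspace \<real> V) (V - zero_locus {\<lambda>x. x$i ^ d}).
    \<forall>x. r (proj_point x) = f x / x$i ^ d"
proof -
  obtain a b where ab: "a \<in> hpoly \<real> d" "b \<in> hpoly \<real> d" "f = (\<lambda>x. a x + \<i> * b x)"
    using hpoly_complex_split[OF f] .
  let ?h = "\<lambda>x::complex^'n. x$i ^ d"
  have h: "?h \<in> hpoly \<real> d"
    by (rule real_coeff.hpoly_coord_power)
  show ?thesis
  proof
    show "(\<lambda>P. hquot a ?h P + \<i> * hquot b ?h P) \<in>
        extended_reg (proj_subspace \<real> V) (V - zero_locus {?h})"
      unfolding extended_reg_def proj_subspace_def
      using real_coeff.hquot_regular[OF V ab(1) h] real_coeff.hquot_regular[OF V ab(2) h] by auto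
  qed (simp add: ab(3) hquot_proj_point[OF ab(1) h] hquot_proj_point[OF ab(2) h] add_divide_distrib)
qed

text \<open>A complex form \<open>f\<close> of degree \<open>d\<close> is not itself a function on
  points, but on the real open chart \<open>x$i \<noteq> 0\<close> its nonvanishing locus is that of
  \<open>f / x$i ^ d\<close>, which is an element of the extended ring of that chart.\<close>

lemma base_change_top_proj_subspace:
  fixes V :: "(complex^'n) set set"
  assumes V: "V \<subseteq> proj_space"
  shows "base_change_top (proj_subspace \<real> V) = subtopology (zariski UNIV) V"
proof (intro topology_eq[THEN iffD2] allI iffI)
  let ?X = "proj_subspace \<real> V"
  let ?B = "{{p \<in> U. h p \<noteq> 0} | U h. openin (zar ?X) U \<and> h \<in> extended_reg ?X U}"
  fix W
  {
    assume "openin (base_change_top ?X) W"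
    then have "generate_topology_on ?B W"
      unfolding base_change_top_def openin_topology_generated_by_iff .
    then show "openin (subtopology (zariski UNIV) V) W"
    proof induction
      case (Basis s)
      then show ?case
        using openin_regular_nonzero[OF V extended_reg_regular[OF V]] by auto
    qed (auto intro: openin_Union)
  }
  {
    assume W: "openin (subtopology (zariski UNIV) V) W"
    have "\<exists>T. openin (base_change_top ?X) T \<and> P \<in> T \<and> T \<subseteq> W" if P: "P \<in> W" for P
    proof -
      obtain x where x: "x \<noteq> 0" "P = proj_point x" "P \<in> V"
        using P complex_coeff.openin_subzariski_subset[OF V W] V by (meson subset_proj_spaceE subsetD)
      obtain f d where f: "f \<in> hpoly UNIV d" "f x \<noteq> 0"
        "\<And>y. y \<noteq> 0 \<Longrightarrow> f y \<noteq> 0 \<Longrightarrow> proj_point y \<in> V \<Longrightarrow> proj_point y \<in> W"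
        using complex_coeff.openin_subzariskiE[OF V W] x P by metis
      obtain i where i: "x$i \<noteq> 0"
        using x(1) by (auto simp: vec_eq_iff)
      let ?h = "\<lambda>x::complex^'n. x$i ^ d"
      have h: "?h \<in> hpoly \<real> d"
        by (rule real_coeff.hpoly_coord_power)
      obtain r where r: "r \<in> extended_reg ?X (V - zero_locus {?h})"
        "\<And>x. r (proj_point x) = f x / x$i ^ d"
        using hquot_extended_reg[OF V f(1)] by blast
      have "openin (zar ?X) (V - zero_locus {?h})"
        using real_coeff.openin_subzariski_nonvanishing[OF V h] by (simp add: proj_subspace_def)
      then have "openin (base_change_top ?X) {p \<in> V - zero_locus {?h}. r p \<noteq> 0}"
        unfolding base_change_top_def
        by (intro topology_generated_by_Basis) (use r(1) in blast)
      moreover have "P \<in> {p \<in> V - zero_locus {?h}. r p \<noteq> 0}"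
        using x i f r by (simp add: proj_point_in_zero_locus[OF h])
      moreover have "{p \<in> V - zero_locus {?h}. r p \<noteq> 0} \<subseteq> W"
      proof
        fix Q assume Q: "Q \<in> {p \<in> V - zero_locus {?h}. r p \<noteq> 0}"
        then obtain y where "y \<noteq> 0" "Q = proj_point y"
          using V by (auto elim: subset_proj_spaceE)
        then show "Q \<in> W"
          using Q f(3)[of y] by (auto simp: r(2))
      qed
      ultimately show ?thesis by blast
    qed
    then show "openin (base_change_top ?X) W"
      by (subst openin_subopen) blast
  }
qed

lemma base_change_reg_proj_subspace:
  fixes V :: "(complex^'n) set set"
  assumes V: "V \<subseteq> proj_space"
  shows "base_change_reg (proj_subspace \<real> V) W = regular_fun UNIV V W"
proof (intro set_eqI iffI)
  let ?X = "proj_subspace \<real> V"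
  note top = base_change_top_proj_subspace[OF V]
  fix f
  {
    assume f: "f \<in> base_change_reg ?X W"
    show "f \<in> regular_fun UNIV V W"
    proof (rule complex_coeff.regular_funI[OF V])
      show "W \<subseteq> V"
        using f complex_coeff.openin_subzariski_subset[OF V]
        unfolding base_change_reg_def top by blast
      fix x :: "complex^'n"
      assume x: "x \<noteq> 0" "proj_point x \<in> W"
      obtain W' U g h where W': "openin (subtopology (zariski UNIV) V) W'" "proj_point x \<in> W'"
          "W' \<subseteq> W" "W' \<subseteq> U"
        and gh: "g \<in> extended_reg ?X U" "h \<in> extended_reg ?X U"
          "\<forall>q\<in>W'. h q \<noteq> 0 \<and> f q = g q / h q"
        using f[unfolded base_change_reg_def top mem_Collect_eq, THEN bspec, OF x(2)]
        by (elim exE conjE) (rule that)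
      obtain w e where w: "w \<in> hpoly UNIV e" "w x \<noteq> 0"
        "\<And>y. y \<noteq> 0 \<Longrightarrow> w y \<noteq> 0 \<Longrightarrow> proj_point y \<in> V \<Longrightarrow> proj_point y \<in> W'"
        by (rule complex_coeff.openin_subzariskiE[OF V W'(1) x(1) W'(2)]) (rule that)
      obtain d a b where 1: "a \<in> hpoly UNIV d" "b \<in> hpoly UNIV d" "b x \<noteq> 0"
        "\<And>y. y \<noteq> 0 \<Longrightarrow> b y \<noteq> 0 \<Longrightarrow> proj_point y \<in> V \<Longrightarrow>
            proj_point y \<in> U \<and> g (proj_point y) = a y / b y"
        by (rule complex_coeff.regular_funE[OF V extended_reg_regular[OF V gh(1)] x(1)
              subsetD[OF W'(4,2)]]) (rule that)
      obtain d' a' b' where 2: "a' \<in> hpoly UNIV d'" "b' \<in> hpoly UNIV d'" "b' x \<noteq> 0"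
        "\<And>y. y \<noteq> 0 \<Longrightarrow> b' y \<noteq> 0 \<Longrightarrow> proj_point y \<in> V \<Longrightarrow>
            proj_point y \<in> U \<and> h (proj_point y) = a' y / b' y"
        by (rule complex_coeff.regular_funE[OF V extended_reg_regular[OF V gh(2)] x(1)
              subsetD[OF W'(4,2)]]) (rule that)
      \<comment> \<open>The compound fraction \<open>(a / b) / (a' / b')\<close> is extended by
        \<open>b' * w\<close>: a nonzero \<open>b'\<close> validates the local formula for
        \<open>h\<close>, and a nonzero \<open>w\<close> forces the point into
        \<open>W'\<close>.\<close>
      let ?n = "\<lambda>x. (a x * b' x) * (b' x * w x)" and ?m = "\<lambda>x. (b x * a' x) * (b' x * w x)"
      have "x \<noteq> 0" "proj_point x \<in> V"
        using x \<open>W \<subseteq> V\<close> by auto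
      then have "a' x \<noteq> 0"
        using gh(3)[rule_format, of "proj_point x"] 2(3) 2(4)[of x] W'(2) by auto
      have "?n \<in> hpoly UNIV (d + d' + (d' + e))" "?m \<in> hpoly UNIV (d + d' + (d' + e))"
        by (intro complex_coeff.hpoly_mult 1 2 w)+
      moreover have "?m x \<noteq> 0"
        using 1 2 w \<open>a' x \<noteq> 0\<close> by simp
      moreover have "proj_point y \<in> W \<and> f (proj_point y) = ?n y / ?m y"
        if "y \<noteq> 0" "?m y \<noteq> 0" "proj_point y \<in> V" for y
      proof -
        have "proj_point y \<in> W'" using that w by auto
        moreover from this have "f (proj_point y) = (a y / b y) / (a' y / b' y)"
          using gh(3)[rule_format, of "proj_point y"] 1(4)[of y] 2(4)[of y] that by auto
        ultimately show ?thesis using W' that by auto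
      qed
      ultimately show "\<exists>d g h. g \<in> hpoly UNIV d \<and> h \<in> hpoly UNIV d \<and> h x \<noteq> 0 \<and>
          (\<forall>y. y \<noteq> 0 \<and> h y \<noteq> 0 \<and> proj_point y \<in> V \<longrightarrow>
            proj_point y \<in> W \<and> f (proj_point y) = g y / h y)"
        by blast
    qed
  }
  {
    assume f: "f \<in> regular_fun UNIV V W"
    show "f \<in> base_change_reg ?X W"
      unfolding base_change_reg_def mem_Collect_eq top
    proof
      fix P assume P: "P \<in> W"
      then obtain x where x: "x \<noteq> 0" "P = proj_point x" "P \<in> V"
        using P complex_coeff.regular_fun_subset[OF V f] V by (meson subset_proj_spaceE subsetD)
      obtain d g h where gh: "g \<in> hpoly UNIV d" "h \<in> hpoly UNIV d" "h x \<noteq> 0"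
        "\<And>y. y \<noteq> 0 \<Longrightarrow> h y \<noteq> 0 \<Longrightarrow> proj_point y \<in> V \<Longrightarrow>
            proj_point y \<in> W \<and> f (proj_point y) = g y / h y"
        by (rule complex_coeff.regular_funE[OF V f x(1) P[unfolded x(2)]]) (rule that)
      obtain i where i: "x$i \<noteq> 0"
        using x(1) by (auto simp: vec_eq_iff)
      let ?c = "\<lambda>x::complex^'n. x$i ^ d"
      have c: "?c \<in> hpoly \<real> d"
        by (rule real_coeff.hpoly_coord_power)
      have hc: "(\<lambda>x. h x * ?c x) \<in> hpoly UNIV (d + d)"
        by (intro complex_coeff.hpoly_mult gh hpoly_real_imp_complex[OF c])
      obtain r where r: "r \<in> extended_reg ?X (V - zero_locus {?c})"
        "\<And>x. r (proj_point x) = g x / x$i ^ d"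
        using hquot_extended_reg[OF V gh(1)] by blast
      obtain s where s: "s \<in> extended_reg ?X (V - zero_locus {?c})"
        "\<And>x. s (proj_point x) = h x / x$i ^ d"
        using hquot_extended_reg[OF V gh(2)] by blast
      \<comment> \<open>Here both \<open>h\<close> and the chosen coordinate are nonzero, so
        \<open>f\<close> is the quotient of \<open>g / x$i ^ d\<close> by
        \<open>h / x$i ^ d\<close>, both of which are extended regular functions on one real
        chart.\<close>
      let ?W' = "V - zero_locus {\<lambda>x. h x * ?c x}"
      have W'D: "\<exists>y. y \<noteq> 0 \<and> Q = proj_point y \<and> h y \<noteq> 0 \<and> y$i ^ d \<noteq> 0" if Q: "Q \<in> ?W'" for Q
      proof -
        obtain y where "y \<noteq> 0" "Q = proj_point y"
          using Q V by (meson DiffD1 subset_proj_spaceE)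
        then show ?thesis
          using Q by (intro exI[of _ y]) (simp add: proj_point_in_zero_locus[OF hc])
      qed
      have "openin (subtopology (zariski UNIV) V) ?W'"
        by (rule complex_coeff.openin_subzariski_nonvanishing[OF V hc])
      moreover have "P \<in> ?W'"
        using x gh i by (simp add: proj_point_in_zero_locus[OF hc])
      moreover have "?W' \<subseteq> W"
        using W'D gh(4) by blast
      moreover have "openin (zar ?X) (V - zero_locus {?c})"
        using real_coeff.openin_subzariski_nonvanishing[OF V c] by (simp add: proj_subspace_def)
      moreover have "?W' \<subseteq> V - zero_locus {?c}"
      proof
        fix Q assume Q: "Q \<in> ?W'"
        then obtain y where "y \<noteq> 0" "Q = proj_point y" "y$i ^ d \<noteq> 0"
          using W'D by blast
        then show "Q \<in> V - zero_locus {?c}"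
          using Q by (simp add: proj_point_in_zero_locus[OF c])
      qed
      moreover have "\<forall>Q\<in>?W'. s Q \<noteq> 0 \<and> f Q = r Q / s Q"
      proof
        fix Q assume Q: "Q \<in> ?W'"
        then obtain y where "y \<noteq> 0" "Q = proj_point y" "h y \<noteq> 0" "y$i ^ d \<noteq> 0"
          using W'D by blast
        then show "s Q \<noteq> 0 \<and> f Q = r Q / s Q"
          using Q gh(4)[of y] by (simp add: r(2) s(2))
      qed
      ultimately show "\<exists>W' U g h. openin (subtopology (zariski UNIV) V) W' \<and> P \<in> W' \<and> W' \<subseteq> W \<and>
           openin (zar ?X) U \<and> W' \<subseteq> U \<and> g \<in> extended_reg ?X U \<and> h \<in> extended_reg ?X U \<and>
           (\<forall>q \<in> W'. h q \<noteq> 0 \<and> f q = g q / h q)"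
        using r(1) s(1) by blast
    qed
  }
qed

text \<open>An equality and not just an isomorphism: the base change of a real hypersurface is the
  complex hypersurface with the same equation.\<close>

lemma base_change_proj_subspace:
  "V \<subseteq> proj_space \<Longrightarrow> base_change (proj_subspace \<real> V) = proj_subspace UNIV V"
  using base_change_top_proj_subspace[of V] base_change_reg_proj_subspace[of V]
  by (simp add: base_change_def proj_subspace_def[of UNIV] fun_eq_iff)

section \<open>Morphisms\<close>

lemma isomorphic_sym: "isomorphic X Y \<Longrightarrow> isomorphic Y X"
  unfolding isomorphic_def by blast

text \<open>\<open>\<phi>\<close> is continuous, and onto because \<open>\<psi>\<close> supplies
  preimages; nonempty open sets therefore pull back to nonempty open sets, which must meet.\<close>

lemma irreducible_space_isomorphic:
  assumes "isomorphic X Y" "irreducible_space (zar X)"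
  shows "irreducible_space (zar Y)"
proof -
  obtain \<phi> \<psi> where mor: "morphism X Y \<phi>" "morphism Y X \<psi>"
    and "\<forall>p\<in>topspace (zar X). \<psi> (\<phi> p) = p" and inv: "\<forall>q\<in>topspace (zar Y). \<phi> (\<psi> q) = q"
    using assms(1) unfolding isomorphic_def by (elim exE conjE) (rule that)
  then have cont: "continuous_map (zar X) (zar Y) \<phi>" "continuous_map (zar Y) (zar X) \<psi>"
    unfolding morphism_def by auto
  let ?pre = "\<lambda>U. {p \<in> topspace (zar X). \<phi> p \<in> U}"
  have pre: "openin (zar X) (?pre U)" "?pre U \<noteq> {}" if U: "openin (zar Y) U" "U \<noteq> {}" for U
  proof -
    show "openin (zar X) (?pre U)"
      using cont(1) U(1) by (rule openin_continuous_map_preimage)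
    obtain q where q: "q \<in> U" "q \<in> topspace (zar Y)"
      using U(2) openin_subset[OF U(1)] by blast
    then have "\<psi> q \<in> ?pre U"
      using cont(2) inv by (auto simp: continuous_map_def)
    then show "?pre U \<noteq> {}" by blast
  qed
  have "U \<inter> V \<noteq> {}" if "openin (zar Y) U" "openin (zar Y) V" "U \<noteq> {}" "V \<noteq> {}" for U V
  proof -
    have "?pre U \<inter> ?pre V \<noteq> {}"
      using assms(2) pre[OF that(1,3)] pre[OF that(2,4)] unfolding irreducible_space_def by blast
    then show ?thesis by blast
  qed
  moreover have "topspace (zar Y) \<noteq> {}"
    using assms(2) cont(1) unfolding irreducible_space_def continuous_map_def by blast
  ultimately show ?thesis
    unfolding irreducible_space_def by blast
qed

lemma proj_point_image: "proj_point x = (\<lambda>c. c *s x) ` {c. c \<noteq> 0}"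
  unfolding proj_point_def by blast

context coeff_ring
begin

lemma linear_image_proj_point:
  fixes L :: "complex^'n \<Rightarrow> complex^'m"
  assumes "\<And>i. (\<lambda>x. L x $ i) \<in> hpoly k 1"
  shows "L ` proj_point x = proj_point (L x)"
proof -
  have "L (c *s x) = c *s L x" for c
    using hpoly_homogeneous[OF assms] by (simp add: vec_eq_iff)
  then show ?thesis
    by (simp add: proj_point_image image_image)
qed

text \<open>Points are sets of vectors, so the induced map on them is the image map of
  \<open>L\<close>. Substituting \<open>L\<close> into the forms that witness openness or regularity
  preserves their degrees.\<close>

lemma linear_morphism:
  fixes L :: "complex^'n \<Rightarrow> complex^'m"
  assumes V: "V \<subseteq> proj_space" and V': "V' \<subseteq> proj_space"
    and L: "\<And>i. (\<lambda>x. L x $ i) \<in> hpoly k 1"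
    and nz: "\<And>x. x \<noteq> 0 \<Longrightarrow> L x \<noteq> 0"
    and into: "\<And>x. x \<noteq> 0 \<Longrightarrow> proj_point x \<in> V \<Longrightarrow> proj_point (L x) \<in> V'"
  shows "morphism (proj_subspace k V) (proj_subspace k V') ((`) L)"
proof -
  note img = linear_image_proj_point[OF L]
  have "L ` P \<in> V'" if "P \<in> V" for P
    using subset_proj_spaceE[OF that V] into that img by metis
  moreover have "openin (subtopology (zariski k) V) {P \<in> V. L ` P \<in> U}"
    if U: "openin (subtopology (zariski k) V') U" for U
    unfolding openin_subzariski_iff[OF V]
  proof (intro conjI allI impI)
    fix x :: "complex^'n"
    assume x: "x \<noteq> 0 \<and> proj_point x \<in> {P \<in> V. L ` P \<in> U}"
    then obtain f d where f: "f \<in> hpoly k d" "f (L x) \<noteq> 0"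
      "\<And>y. y \<noteq> 0 \<Longrightarrow> f y \<noteq> 0 \<Longrightarrow> proj_point y \<in> V' \<Longrightarrow> proj_point y \<in> U"
      using openin_subzariskiE[OF V' U, of "L x"] nz[of x] by (auto simp: img)
    show "\<exists>f d. f \<in> hpoly k d \<and> f x \<noteq> 0 \<and>
        (\<forall>y. y \<noteq> 0 \<and> f y \<noteq> 0 \<and> proj_point y \<in> V \<longrightarrow> proj_point y \<in> {P \<in> V. L ` P \<in> U})"
      by (intro exI[of _ "\<lambda>x. f (L x)"] exI[of _ d] conjI hpoly_compose_linear[OF f(1) L])
        (use f nz into in \<open>auto simp: img\<close>)
  qed auto
  moreover have "f \<circ> (`) L \<in> regular_fun k V {P \<in> V. L ` P \<in> U}"
    if f: "f \<in> regular_fun k V' U" for f U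
  proof (rule regular_funI[OF V])
    fix x :: "complex^'n"
    assume x: "x \<noteq> 0" "proj_point x \<in> {P \<in> V. L ` P \<in> U}"
    then have "proj_point (L x) \<in> U" by (simp add: img)
    then obtain d g h where gh: "g \<in> hpoly k d" "h \<in> hpoly k d" "h (L x) \<noteq> 0"
      "\<And>y. y \<noteq> 0 \<Longrightarrow> h y \<noteq> 0 \<Longrightarrow> proj_point y \<in> V' \<Longrightarrow>
        proj_point y \<in> U \<and> f (proj_point y) = g y / h y"
      by (rule regular_funE[OF V' f nz[OF x(1)]]) (rule that)
    show "\<exists>d g h. g \<in> hpoly k d \<and> h \<in> hpoly k d \<and> h x \<noteq> 0 \<and>
        (\<forall>y. y \<noteq> 0 \<and> h y \<noteq> 0 \<and> proj_point y \<in> V \<longrightarrow>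
          proj_point y \<in> {P \<in> V. L ` P \<in> U} \<and> (f \<circ> (`) L) (proj_point y) = g y / h y)"
      by (intro exI[of _ "\<lambda>x. g (L x)"] exI[of _ "\<lambda>x. h (L x)"] exI[of _ d] conjI
          hpoly_compose_linear[OF gh(1) L] hpoly_compose_linear[OF gh(2) L])
        (use gh(3,4) nz into in \<open>auto simp: img\<close>)
  qed auto
  ultimately show ?thesis
    using V V' by (auto simp: morphism_def proj_subspace_def continuous_map_def Int_absorb1)
qed

lemma isomorphic_hypersurface_linear:
  fixes L :: "complex^'n \<Rightarrow> complex^'m" and M :: "complex^'m \<Rightarrow> complex^'n"
  assumes F: "F \<in> hpoly k d" and G: "G \<in> hpoly k e"
    and L: "\<And>i. (\<lambda>x. L x $ i) \<in> hpoly k 1" and M: "\<And>i. (\<lambda>x. M x $ i) \<in> hpoly k 1"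
    and inv: "\<And>x. M (L x) = x" "\<And>y. L (M y) = y"
    and eq: "\<And>x. G (L x) = F x"
  shows "isomorphic (hypersurface k F) (hypersurface k G)"
proof -
  have "c *s L x = L (c *s x)" "c *s M y = M (c *s y)" for c x y
    using hpoly_homogeneous[OF L] hpoly_homogeneous[OF M] by (simp_all add: vec_eq_iff)
  \<comment> \<open>Scaling by 0 gives the value at 0; with the mutual inverses it follows that
    nonzero vectors correspond to nonzero vectors.\<close>
  from this[of 0] have "L 0 = 0" "M 0 = 0" by auto
  then have nz: "L x \<noteq> 0 \<longleftrightarrow> x \<noteq> 0" "M y \<noteq> 0 \<longleftrightarrow> y \<noteq> 0" for x y
    using inv by metis+
  have "morphism (hypersurface k F) (hypersurface k G) ((`) L)"
    unfolding hypersurface_def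
    by (intro linear_morphism L zero_locus_subset)
      (simp_all add: nz proj_point_in_zero_locus[OF F] proj_point_in_zero_locus[OF G] eq)
  moreover have "morphism (hypersurface k G) (hypersurface k F) ((`) M)"
    unfolding hypersurface_def
    by (intro linear_morphism M zero_locus_subset)
      (simp_all add: nz proj_point_in_zero_locus[OF F] proj_point_in_zero_locus[OF G] eq[symmetric] inv)
  ultimately show ?thesis
    unfolding isomorphic_def
    by (intro exI[of _ "(`) L"] exI[of _ "(`) M"]) (simp add: image_image inv)
qed

lemma variety_hypersurface:
  fixes F :: "complex^'n \<Rightarrow> complex"
  assumes "F \<in> hpoly k d" "irreducible_space (zar (hypersurface k F))"
  shows "variety k (hypersurface k F)"
proof -
  \<comment> \<open>\<open>variety\<close> asks for a difference of two zero loci; the constant form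
    1, of degree 0, provides the empty set to subtract.\<close>
  have "zero_locus {\<lambda>x::complex^'n. 1} = {}"
  proof (rule equals0I)
    fix P assume P: "P \<in> zero_locus {\<lambda>x::complex^'n. 1}"
    then obtain x :: "complex^'n" where "x \<noteq> 0" "P = proj_point x"
      using subset_proj_spaceE[OF _ zero_locus_subset] by metis
    then show False
      using P proj_point_in_zero_locus[OF hpoly_const[OF one_closed], of x] by simp
  qed
  then have "hypersurface k F = proj_subspace k (zero_locus {F} - zero_locus {\<lambda>x. 1})"
    by (simp add: hypersurface_def)
  moreover have "{F} \<subseteq> (\<Union>d. hpoly k d)" "{\<lambda>x::complex^'n. 1} \<subseteq> (\<Union>d. hpoly k d)"
    using assms(1) hpoly_const[OF one_closed] by blast+
  ultimately show ?thesis
    using assms(2) unfolding variety_def by blast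
qed

end

lemma openin_zariski_real_imp_complex:
  "openin (zariski \<real>) U \<Longrightarrow> openin (zariski UNIV) U"
  unfolding real_coeff.openin_zariski_iff complex_coeff.openin_zariski_iff
  using hpoly_real_imp_complex by meson

text \<open>On the same set of points the real Zariski topology is coarser, so there are fewer pairs
  of open sets to test.\<close>

lemma irreducible_space_real:
  assumes "irreducible_space (zar (hypersurface UNIV F))"
  shows "irreducible_space (zar (hypersurface \<real> F))"
proof -
  have "openin (subtopology (zariski UNIV) V) U" if "openin (subtopology (zariski \<real>) V) U"
    for U V :: "(complex^'n) set set"
    using that openin_zariski_real_imp_complex by (auto simp: openin_subtopology)
  then show ?thesis
    using assms unfolding irreducible_space_def hypersurface_def proj_subspace_def
    by (simp add: zero_locus_subset) blast
qed

lemma real_form_hypersurface: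
  assumes F: "F \<in> hpoly \<real> d" and G: "G \<in> hpoly UNIV e"
    and irr: "irreducible_space (zar (hypersurface UNIV G))"
    and iso: "isomorphic (hypersurface UNIV F) (hypersurface UNIV G)"
  shows "real_form (hypersurface \<real> F) (hypersurface UNIV G)"
proof -
  have "variety \<real> (hypersurface \<real> F)"
    using irreducible_space_isomorphic[OF isomorphic_sym[OF iso] irr]
    by (intro real_coeff.variety_hypersurface[OF F] irreducible_space_real)
  moreover have "base_change (hypersurface \<real> F) = hypersurface UNIV F"
    unfolding hypersurface_def by (intro base_change_proj_subspace zero_locus_subset)
  ultimately show ?thesis
    unfolding real_form_def using iso complex_coeff.variety_hypersurface[OF G irr] by simp
qed

section \<open>Irreducibility of the Fermat quartic surface\<close>

lemma csqrt_csqrt_power4: "csqrt (csqrt z) ^ 4 = z"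
  using power_mult[of "csqrt (csqrt z)" 2 2] by simp

text \<open>Numerals of the index type are read modulo 4: the index that \<open>UNIV_4\<close>,
  \<open>forall_4\<close> and \<open>sum_4\<close> call 4 is the one written 0 in the
  quartics.\<close>

lemma four_eq_zero: "(4::4) = 0"
  by simp

lemma UNIV_4': "(UNIV :: 4 set) = {0, 1, 2, 3}"
  unfolding UNIV_4 four_eq_zero by (simp only: insert_commute)

lemma forall_4': "(\<forall>i::4. P i) \<longleftrightarrow> P 0 \<and> P 1 \<and> P 2 \<and> P 3"
  unfolding forall_4 four_eq_zero by (simp only: conj_ac)

lemma sum_lessThan_4: "(\<Sum>k<4::nat. f k) = f 0 + f 1 + f 2 + f 3"
  by (simp add: eval_nat_numeral)

text \<open>A local parametrisation of the curve \<open>a\<^sup>4 + b\<^sup>4 = 1\<close> by \<open>b = s\<close> near \<open>(1, 0)\<close>.\<close>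

definition branch :: "complex \<Rightarrow> complex" where
  "branch s = csqrt (csqrt (1 - s ^ 4))"

lemma branch_on_curve: "branch s ^ 4 + s ^ 4 = 1"
  by (simp add: branch_def csqrt_csqrt_power4)

text \<open>On the unit disc \<open>1 - s ^ 4\<close> lies in the open right half plane, and so does
  its principal square root; neither root meets its branch cut.\<close>

lemma holomorphic_branch: "branch holomorphic_on ball 0 1"
proof -
  have 0: "Re (1 - s ^ 4) > 0" if "s \<in> ball 0 1" for s :: complex
  proof -
    have "norm (s ^ 4) < 1"
      using that by (simp add: norm_power power_less_one_iff)
    then show ?thesis
      using abs_Re_le_cmod[of "s ^ 4"] by simp
  qed
  then have 1: "1 - s ^ 4 \<notin> \<real>\<^sub>\<le>\<^sub>0" if "s \<in> ball 0 1" for s :: complex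
    using 0[OF that] by (force simp: complex_nonpos_Reals_iff)
  have "0 < Re (csqrt (1 - s ^ 4))" if "s \<in> ball 0 1" for s :: complex
    using add_nonneg_pos[OF norm_ge_zero 0[OF that]] by simp
  then have 2: "csqrt (1 - s ^ 4) \<notin> \<real>\<^sub>\<le>\<^sub>0" if "s \<in> ball 0 1" for s :: complex
    using that by (fastforce simp: complex_nonpos_Reals_iff)
  show ?thesis
    unfolding branch_def by (intro holomorphic_intros) (use 1 2 in auto)
qed

text \<open>The four points \<open>(branch s, \<i>\<^sup>j s)\<close> of the curve have the same first coordinate, so that a
  polynomial of degree at most 3 in \<open>b\<close> vanishing at all of them is zero.\<close>

lemma curve_poly_eq_0:
  fixes p :: "nat \<Rightarrow> complex poly"
  assumes "\<And>s. s \<in> ball 0 1 \<Longrightarrow> (\<Sum>k<4. poly (p k) (branch s) * s ^ k) = 0" and "k < 4"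
  shows "p k = 0"
proof -
  have root: "poly (p k) (branch s) = 0" if s: "s \<in> ball 0 1" "s \<noteq> 0" for s
  proof -
    define c where "c k = poly (p k) (branch s) * s ^ k" for k
    have "(\<Sum>k<4. c k * w ^ k) = 0" if "w ^ 4 = 1" "norm w = 1" for w
    proof -
      have "branch (w * s) = branch s"
        using that by (simp add: branch_def power_mult_distrib)
      then show ?thesis
        using assms(1)[of "w * s"] s that by (simp add: c_def power_mult_distrib norm_mult mult_ac)
    qed
    \<comment> \<open>Evaluation at the four fourth roots of unity is an invertible (discrete
      Fourier) system in \<open>c 0, ..., c 3\<close>; sums and differences of the equations solve
      it.\<close>
    from this[of 1] this[of "-1"] this[of \<i>] this[of "-\<i>"]
    have eq: "c 0 + c 1 + c 2 + c 3 = 0" "c 0 - c 1 + c 2 - c 3 = 0"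
      "c 0 + \<i> * c 1 - c 2 - \<i> * c 3 = 0" "c 0 - \<i> * c 1 - c 2 + \<i> * c 3 = 0"
      by (simp_all add: sum_lessThan_4 power3_eq_cube power4_eq_xxxx algebra_simps)
    have "2 * (c 0 + c 2) = (c 0 + c 1 + c 2 + c 3) + (c 0 - c 1 + c 2 - c 3)"
      "2 * (c 1 + c 3) = (c 0 + c 1 + c 2 + c 3) - (c 0 - c 1 + c 2 - c 3)"
      "2 * (c 0 - c 2) = (c 0 + \<i> * c 1 - c 2 - \<i> * c 3) + (c 0 - \<i> * c 1 - c 2 + \<i> * c 3)"
      "2 * \<i> * (c 1 - c 3) = (c 0 + \<i> * c 1 - c 2 - \<i> * c 3) - (c 0 - \<i> * c 1 - c 2 + \<i> * c 3)"
      by (simp_all add: algebra_simps)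
    then have sums: "c 0 + c 2 = 0" "c 1 + c 3 = 0" and "c 0 - c 2 = 0" "c 1 - c 3 = 0"
      unfolding eq by simp_all
    then have diffs: "c 0 = c 2" "c 1 = c 3" by simp_all
    have "2 * c 2 = 0" "2 * c 3 = 0"
      using sums unfolding diffs by simp_all
    then have "c 2 = 0" "c 3 = 0" by simp_all
    with diffs have "c 0 = 0" "c 1 = 0" "c 2 = 0" "c 3 = 0" by simp_all
    moreover have "k = 0 \<or> k = 1 \<or> k = 2 \<or> k = 3"
      using \<open>k < 4\<close> by auto
    ultimately have "c k = 0" by auto
    then show ?thesis using s by (simp add: c_def)
  qed
  \<comment> \<open>The fourth power of \<open>branch t\<close> is \<open>1 - t ^ 4\<close>, which
    separates the reals between 0 and 1. So \<open>p k\<close> has infinitely many roots.\<close>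
  have "inj_on (\<lambda>t. branch (of_real t)) {0<..<1::real}"
  proof (rule inj_onI)
    fix t u :: real
    assume tu: "t \<in> {0<..<1}" "u \<in> {0<..<1}" "branch t = branch u"
    then have "complex_of_real t ^ 4 = complex_of_real u ^ 4"
      using branch_on_curve[of t] branch_on_curve[of u] by (metis add_left_cancel)
    then have "t ^ 4 = u ^ 4" by (simp flip: of_real_power)
    then show "t = u" using tu by (simp add: power_eq_iff_eq_base)
  qed
  then have "infinite ((\<lambda>t. branch (of_real t)) ` {0<..<1::real})"
    by (simp add: finite_image_iff infinite_Ioo)
  moreover have "(\<lambda>t. branch (of_real t)) ` {0<..<1::real} \<subseteq> {z. poly (p k) z = 0}"
    using root by auto
  ultimately show ?thesis
    using poly_roots_finite finite_subset by blast
qed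

text \<open>The coordinate ring of the curve, presented over the polynomials in \<open>a\<close> by
  the generators \<open>1, b, b^2, b^3\<close>. The formula is prescribed on the curve only.\<close>

definition curve_polys :: "(complex \<Rightarrow> complex \<Rightarrow> complex) set" where
  "curve_polys = {G. \<exists>p :: nat \<Rightarrow> complex poly. \<forall>a b. a ^ 4 + b ^ 4 = 1 \<longrightarrow>
      G a b = (\<Sum>k<4. poly (p k) a * b ^ k)}"

text \<open>Pulled back along \<open>branch\<close>, a function in \<open>curve_polys\<close> that
  is nonzero somewhere on the curve becomes holomorphic and not identically zero on the disc. The
  identity theorem then yields a common point of nonvanishing.\<close>

lemma curve_irreducible:
  assumes G: "G \<in> curve_polys" "a ^ 4 + b ^ 4 = 1" "G a b \<noteq> 0"
    and H: "H \<in> curve_polys" "c ^ 4 + d ^ 4 = 1" "H c d \<noteq> 0"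
  obtains a' b' where "a' ^ 4 + b' ^ 4 = 1" "G a' b' \<noteq> 0" "H a' b' \<noteq> 0"
proof -
  obtain p :: "nat \<Rightarrow> complex poly" where p: "\<And>a b. a ^ 4 + b ^ 4 = 1 \<Longrightarrow> G a b = (\<Sum>k<4. poly (p k) a * b ^ k)"
    using G(1) unfolding curve_polys_def by auto
  obtain q :: "nat \<Rightarrow> complex poly" where q: "\<And>a b. a ^ 4 + b ^ 4 = 1 \<Longrightarrow> H a b = (\<Sum>k<4. poly (q k) a * b ^ k)"
    using H(1) unfolding curve_polys_def by auto
  define g where "g s = (\<Sum>k<4. poly (p k) (branch s) * s ^ k)" for s
  define h where "h s = (\<Sum>k<4. poly (q k) (branch s) * s ^ k)" for s
  have gh: "g s = G (branch s) s" "h s = H (branch s) s" for s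
    using p q by (simp_all add: g_def h_def branch_on_curve)
  have hol: "(\<lambda>s. \<Sum>k<4. poly (r k) (branch s) * s ^ k) holomorphic_on ball 0 1"
    for r :: "nat \<Rightarrow> complex poly"
    unfolding poly_altdef by (intro holomorphic_intros holomorphic_branch)
  have hol: "g holomorphic_on ball 0 1" "h holomorphic_on ball 0 1"
    using hol[of p] hol[of q] unfolding g_def[abs_def] h_def[abs_def] .
  obtain s where s: "s \<in> ball 0 1" "g s \<noteq> 0"
    using curve_poly_eq_0[of p] p[OF G(2)] G(3) unfolding g_def
    by (metis (no_types, lifting) lessThan_iff mult_zero_left poly_0 sum.neutral)
  obtain t where t: "t \<in> ball 0 1" "h t \<noteq> 0"
    using curve_poly_eq_0[of q] q[OF H(2)] H(3) unfolding h_def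
    by (metis (no_types, lifting) lessThan_iff mult_zero_left poly_0 sum.neutral)
  have "\<exists>s. g s \<noteq> 0 \<and> h s \<noteq> 0"
  proof (rule ccontr)
    assume no: "\<not> ?thesis"
    have "open {s \<in> ball 0 1. g s \<noteq> 0}"
      using continuous_open_preimage[OF holomorphic_on_imp_continuous_on[OF hol(1)], of "- {0}"]
      by (simp add: vimage_def Int_def open_Compl)
    \<comment> \<open>Under the assumption \<open>no\<close>, \<open>h\<close> vanishes on the
      nonempty open set where \<open>g\<close> does not, hence on the whole disc.\<close>
    then have "h t = 0"
      by (rule analytic_continuation_open[where s' = "ball 0 1" and f = h and g = "\<lambda>_. 0"])
        (use hol s t no in auto)
    then show False using t by simp
  qed
  then show ?thesis
    using that branch_on_curve by (auto simp: gh)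
qed

lemma curve_polys_add:
  assumes "G \<in> curve_polys" "H \<in> curve_polys"
  shows "(\<lambda>a b. G a b + H a b) \<in> curve_polys"
proof -
  obtain p q :: "nat \<Rightarrow> complex poly" where
    "\<And>a b. a ^ 4 + b ^ 4 = 1 \<Longrightarrow> G a b = (\<Sum>k<4. poly (p k) a * b ^ k)"
    "\<And>a b. a ^ 4 + b ^ 4 = 1 \<Longrightarrow> H a b = (\<Sum>k<4. poly (q k) a * b ^ k)"
    using assms unfolding curve_polys_def by auto
  then show ?thesis
    unfolding curve_polys_def mem_Collect_eq
    by (intro exI[of _ "\<lambda>k. p k + q k"]) (simp add: sum.distrib distrib_right)
qed

lemma curve_polys_zero: "(\<lambda>a b. 0) \<in> curve_polys"
  unfolding curve_polys_def mem_Collect_eq by (intro exI[of _ "\<lambda>k. 0"]) simp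

lemma curve_polys_sum:
  "(\<And>i. i \<in> I \<Longrightarrow> G i \<in> curve_polys) \<Longrightarrow> (\<lambda>a b. \<Sum>i\<in>I. G i a b) \<in> curve_polys"
  by (induction I rule: infinite_finite_induct) (auto intro: curve_polys_zero curve_polys_add)

lemma curve_polys_monomial: "(\<lambda>a b. c * a ^ m * b ^ n) \<in> curve_polys"
proof -
  \<comment> \<open>Reduction by \<open>b^4 = 1 - a^4\<close>: the quotient \<open>n div 4\<close>
    becomes a power of \<open>1 - a^4\<close> and the remainder selects the only nonzero
    coefficient.\<close>
  let ?p = "\<lambda>k. if k = n mod 4 then monom c m * (1 - monom 1 4) ^ (n div 4) else 0 :: complex poly"
  have "c * a ^ m * b ^ n = (\<Sum>k<4. poly (?p k) a * b ^ k)" if "a ^ 4 + b ^ 4 = 1" for a b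
  proof -
    have "b ^ n = (b ^ 4) ^ (n div 4) * b ^ (n mod 4)"
      by (simp flip: power_mult power_add)
    also have "b ^ 4 = 1 - a ^ 4" using that by (simp add: algebra_simps)
    finally have "c * a ^ m * b ^ n = poly (?p (n mod 4)) a * b ^ (n mod 4)"
      by (simp add: poly_monom)
    also have "\<dots> = (\<Sum>k\<in>{n mod 4}. poly (?p k) a * b ^ k)" by simp
    also have "\<dots> = (\<Sum>k<4. poly (?p k) a * b ^ k)"
      by (rule sum.mono_neutral_left) auto
    finally show ?thesis .
  qed
  then show ?thesis
    unfolding curve_polys_def mem_Collect_eq by (intro exI[of _ ?p] allI impI)
qed

section \<open>From the curve to the surface, one pair of coordinates at a time\<close>

definition update2 :: "'n \<Rightarrow> complex \<Rightarrow> 'n \<Rightarrow> complex \<Rightarrow> complex^'n \<Rightarrow> complex^'n" where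
  "update2 i a j b x = (\<chi> l. if l = i then a else if l = j then b else x$l)"

text \<open>The scale \<open>z\<close> serves the second pair of coordinates, whose fourth powers
  sum to -1: that pair is \<open>w\<close> times a point of the curve, where
  \<open>w ^ 4 = -1\<close>.\<close>

lemma hpoly_update2_curve_polys:
  assumes "g \<in> hpoly k d" "i \<noteq> j"
  shows "(\<lambda>a b. g (update2 i (z * a) j (z * b) x)) \<in> curve_polys"
proof -
  obtain M c where g: "g = (\<lambda>x. \<Sum>m\<in>M. c m * (\<Prod>l\<in>UNIV. x$l ^ m l))"
    using assms(1) unfolding hpoly_def by auto
  have "c m * (\<Prod>l\<in>UNIV. update2 i (z * a) j (z * b) x $ l ^ m l) =
      (c m * z ^ m i * z ^ m j * (\<Prod>l\<in>UNIV - {i} - {j}. x$l ^ m l)) * a ^ m i * b ^ m j" for a b m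
  proof -
    let ?y = "update2 i (z * a) j (z * b) x"
    have "(\<Prod>l\<in>UNIV. ?y $ l ^ m l) = ?y $ i ^ m i * (?y $ j ^ m j * (\<Prod>l\<in>UNIV - {i} - {j}. ?y $ l ^ m l))"
      using assms(2) by (subst prod.remove[of _ i], simp, simp, subst prod.remove[of _ j]) auto
    also have "(\<Prod>l\<in>UNIV - {i} - {j}. ?y $ l ^ m l) = (\<Prod>l\<in>UNIV - {i} - {j}. x $ l ^ m l)"
      by (rule prod.cong) (auto simp: update2_def)
    finally show ?thesis
      using assms(2) by (simp add: update2_def power_mult_distrib mult_ac)
  qed
  then show ?thesis
    unfolding g by (simp only:) (intro curve_polys_sum curve_polys_monomial)
qed

lemma update2_same: "update2 i (x$i) j (x$j) x = x"
  by (simp add: update2_def vec_eq_iff)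

text \<open>The open subset \<open>x\<^sub>i\<^sup>4 + x\<^sub>j\<^sup>4 \<noteq> 0\<close> of the surface is an image of the product of the curve with itself.\<close>

lemma fermat_chart_irreducible:
  fixes x y :: "complex^4"
  assumes idx: "distinct [i, j, k, l]" "UNIV = {i, j, k, l}"
    and g: "g \<in> hpoly UNIV d" "g x \<noteq> 0" and h: "h \<in> hpoly UNIV e" "h y \<noteq> 0"
    and x: "(\<Sum>n\<in>UNIV. x$n ^ 4) = 0" "x$i ^ 4 + x$j ^ 4 \<noteq> 0"
    and y: "(\<Sum>n\<in>UNIV. y$n ^ 4) = 0" "y$i ^ 4 + y$j ^ 4 \<noteq> 0"
  obtains z where "(\<Sum>n\<in>UNIV. z$n ^ 4) = 0" "z$i ^ 4 + z$j ^ 4 \<noteq> 0" "g z \<noteq> 0" "h z \<noteq> 0"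
proof -
  define w where "w = csqrt (csqrt (-1))"
  have w: "w ^ 4 = -1" unfolding w_def by (rule csqrt_csqrt_power4)
  then have "w \<noteq> 0" by auto
  have sum: "(\<Sum>n\<in>UNIV. u$n ^ 4) = (u$i ^ 4 + u$j ^ 4) + (u$k ^ 4 + u$l ^ 4)" for u :: "complex^4"
    using idx(1) by (simp add: idx(2) add_ac)
  \<comment> \<open>A fourth root of the inverse rescales the first pair onto the curve; the
    equation of the surface then puts the second pair, divided by \<open>w\<close>, on it
    too.\<close>
  have normalise: "\<exists>u. f u \<noteq> 0 \<and> u$i ^ 4 + u$j ^ 4 = 1 \<and> (u$k / w) ^ 4 + (u$l / w) ^ 4 = 1"
    if f: "f \<in> hpoly UNIV d" "f u \<noteq> 0" and u: "(\<Sum>n\<in>UNIV. u$n ^ 4) = 0" "u$i ^ 4 + u$j ^ 4 \<noteq> 0"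
    for f d and u :: "complex^4"
  proof -
    define c where "c = csqrt (csqrt (1 / (u$i ^ 4 + u$j ^ 4)))"
    have c: "c ^ 4 * (u$i ^ 4 + u$j ^ 4) = 1"
      using u(2) by (simp add: c_def csqrt_csqrt_power4)
    then have "c \<noteq> 0" by auto
    have "c ^ 4 * (u$k ^ 4 + u$l ^ 4) = -1"
      using c u(1) unfolding sum by (metis add_eq_0_iff mult_minus_right)
    moreover have "((c *s u)$k / w) ^ 4 + ((c *s u)$l / w) ^ 4 = - (c ^ 4 * (u$k ^ 4 + u$l ^ 4))"
      by (simp add: power_mult_distrib power_divide w distrib_left)
    moreover have "(c *s u)$i ^ 4 + (c *s u)$j ^ 4 = c ^ 4 * (u$i ^ 4 + u$j ^ 4)"
      by (simp add: power_mult_distrib distrib_left)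
    moreover have "f (c *s u) \<noteq> 0"
      using f(2) \<open>c \<noteq> 0\<close> by (simp add: hpoly_homogeneous[OF f(1)])
    ultimately show ?thesis
      using c by (intro exI[of _ "c *s u"]) (simp only: minus_minus simp_thms)
  qed
  obtain x' where x': "g x' \<noteq> 0" "x'$i ^ 4 + x'$j ^ 4 = 1" "(x'$k / w) ^ 4 + (x'$l / w) ^ 4 = 1"
    using normalise[OF g x] by blast
  obtain y' where y': "h y' \<noteq> 0" "y'$i ^ 4 + y'$j ^ 4 = 1" "(y'$k / w) ^ 4 + (y'$l / w) ^ 4 = 1"
    using normalise[OF h y] by blast
  have ne: "i \<noteq> j" "k \<noteq> l" using idx(1) by auto
  \<comment> \<open>The first pair is replaced in \<open>x'\<close> and \<open>y'\<close> by the
    same point of the curve, keeping \<open>g\<close> and \<open>h\<close> nonzero at their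
    respective vectors. The same is done next for the second pair, after which the two vectors
    coincide.\<close>
  obtain a b where ab: "a ^ 4 + b ^ 4 = 1" "g (update2 i a j b x') \<noteq> 0" "h (update2 i a j b y') \<noteq> 0"
    using curve_irreducible[OF hpoly_update2_curve_polys[OF g(1) ne(1), of 1 x'] x'(2) _
        hpoly_update2_curve_polys[OF h(1) ne(1), of 1 y'] y'(2)] x'(1) y'(1)
    by (auto simp: update2_same)
  let ?x = "update2 i a j b x'" and ?y = "update2 i a j b y'"
  have kl: "?x$k = x'$k" "?x$l = x'$l" "?y$k = y'$k" "?y$l = y'$l"
    using idx(1) by (auto simp: update2_def)
  obtain c d where cd: "c ^ 4 + d ^ 4 = 1" "g (update2 k (w * c) l (w * d) ?x) \<noteq> 0"
    "h (update2 k (w * c) l (w * d) ?y) \<noteq> 0"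
    using curve_irreducible[OF hpoly_update2_curve_polys[OF g(1) ne(2), of w ?x] x'(3) _
        hpoly_update2_curve_polys[OF h(1) ne(2), of w ?y] y'(3)] ab \<open>w \<noteq> 0\<close> kl
      update2_same[of k ?x l] update2_same[of k ?y l]
    by auto
  let ?z = "update2 k (w * c) l (w * d) ?x"
  have "n \<in> {i, j, k, l}" for n using idx(2) by auto
  then have "update2 k (w * c) l (w * d) ?y = ?z"
    by (auto simp: update2_def vec_eq_iff)
  moreover have "?z$i = a" "?z$j = b" "?z$k = w * c" "?z$l = w * d"
    using idx(1) by (auto simp: update2_def)
  moreover have "(w * c) ^ 4 + (w * d) ^ 4 = - 1"
    using w cd(1) by (simp add: power_mult_distrib algebra_simps)
  ultimately show ?thesis
    using that[of ?z] cd ab(1) by (simp add: sum)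
qed

lemma fermat_irreducible:
  "irreducible_space (zar (hypersurface UNIV (\<lambda>x::complex^4. x$0 ^ 4 + x$1 ^ 4 + x$2 ^ 4 + x$3 ^ 4)))"
proof -
  define F where "F x = x$0 ^ 4 + x$1 ^ 4 + x$2 ^ 4 + x$3 ^ 4" for x :: "complex^4"
  have F_sum: "F x = (\<Sum>n\<in>UNIV. x$n ^ 4)" for x
    by (simp only: F_def sum_4 four_eq_zero add_ac)
  have F: "F \<in> hpoly UNIV 4"
    unfolding F_def[abs_def] by (intro complex_coeff.hpoly_add complex_coeff.hpoly_coord_power)
  have q: "(\<lambda>x::complex^4. x$0 ^ 4 + x$i ^ 4) \<in> hpoly UNIV 4" for i
    by (intro complex_coeff.hpoly_add complex_coeff.hpoly_coord_power)
  have chart: "\<exists>z. F z = 0 \<and> z$0 ^ 4 + z$i ^ 4 \<noteq> 0 \<and> g z \<noteq> 0 \<and> h z \<noteq> 0"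
    if "i \<in> {1, 2, 3}" "g \<in> hpoly UNIV d" "h \<in> hpoly UNIV e"
      "F x = 0" "x$0 ^ 4 + x$i ^ 4 \<noteq> 0" "g x \<noteq> 0" "F y = 0" "y$0 ^ 4 + y$i ^ 4 \<noteq> 0" "h y \<noteq> 0"
    for i g h d e x y
  proof -
    note a = that
    consider "i = 1" | "i = 2" | "i = 3" using a(1) by auto
    then have "\<exists>k l. distinct [0, i, k, l] \<and> UNIV = {0, i, k, l}"
    proof cases
      case 1
      show ?thesis
        unfolding 1 UNIV_4'
        by (rule exI[of _ "2::4"], rule exI[of _ "3::4"], rule conjI, simp, simp only: insert_commute)
    next
      case 2
      show ?thesis
        unfolding 2 UNIV_4'
        by (rule exI[of _ "1::4"], rule exI[of _ "3::4"], rule conjI, simp, simp only: insert_commute)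
    next
      case 3
      show ?thesis
        unfolding 3 UNIV_4'
        by (rule exI[of _ "1::4"], rule exI[of _ "2::4"], rule conjI, simp, simp only: insert_commute)
    qed
    then obtain k l where kl: "distinct [0, i, k, l]" "UNIV = {0, i, k, l}"
      by (elim exE conjE) (rule that)
    obtain z where "(\<Sum>n\<in>UNIV. z$n ^ 4) = 0" "z$0 ^ 4 + z$i ^ 4 \<noteq> 0" "g z \<noteq> 0" "h z \<noteq> 0"
      by (rule fermat_chart_irreducible[OF kl a(2,6,3,9) a(4)[unfolded F_sum] a(5) a(7)[unfolded F_sum] a(8)])
        (rule that)
    then show ?thesis
      by (intro exI[of _ z] conjI) (simp_all add: F_sum)
  qed
  \<comment> \<open>If all three sums vanish, the equation of the surface reads
    \<open>-2 * x$0 ^ 4 = 0\<close>.\<close>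
  have cover: "\<exists>i\<in>{1, 2, 3}. x$0 ^ 4 + x$i ^ 4 \<noteq> 0" if "F x = 0" "x \<noteq> 0" for x
  proof (rule ccontr)
    assume no: "\<not> ?thesis"
    then have eq: "x$1 ^ 4 = - (x$0 ^ 4)" "x$2 ^ 4 = - (x$0 ^ 4)" "x$3 ^ 4 = - (x$0 ^ 4)"
      by (auto simp: add_eq_0_iff)
    then have "x$0 ^ 4 = 0"
      using that(1) by (simp add: F_def)
    then have "x = 0"
      using eq by (simp add: vec_eq_iff forall_4')
    then show False using that(2) by simp
  qed
  \<comment> \<open>The point \<open>(1, r, r, r)\<close> links the charts: it is on the surface
    because \<open>1 + 3 * r ^ 4 = 0\<close>, and in each chart because
    \<open>1 + r ^ 4 = 2/3\<close>.\<close>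
  define r where "r = csqrt (csqrt (-1/3))"
  define c where "c = ((\<chi> i. if i = 0 then 1 else r) :: complex^4)"
  have r: "r ^ 4 = -1/3" unfolding r_def by (rule csqrt_csqrt_power4)
  have c: "F c = 0" "i \<noteq> 0 \<Longrightarrow> c$0 ^ 4 + c$i ^ 4 \<noteq> 0" for i
    by (simp_all add: F_def c_def r)
  have irr: "\<exists>z. z \<noteq> 0 \<and> F z = 0 \<and> g z \<noteq> 0 \<and> h z \<noteq> 0"
    if x: "x \<noteq> 0" "F x = 0" "g \<in> hpoly UNIV d" "g x \<noteq> 0"
      and y: "y \<noteq> 0" "F y = 0" "h \<in> hpoly UNIV e" "h y \<noteq> 0" for x y g h d e
  proof -
    obtain i where i: "i \<in> {1, 2, 3}" "x$0 ^ 4 + x$i ^ 4 \<noteq> 0"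
      using cover[OF x(2,1)] by blast
    obtain j where j: "j \<in> {1, 2, 3}" "y$0 ^ 4 + y$j ^ 4 \<noteq> 0"
      using cover[OF y(2,1)] by blast
    have "i \<noteq> 0" "j \<noteq> 0" using i j by auto
    \<comment> \<open>Irreducibility of chart \<open>i\<close>, applied to \<open>g\<close> and the
      form defining chart \<open>j\<close>, moves the point into chart \<open>j\<close> without
      leaving the locus \<open>g \<noteq> 0\<close>. There it can be compared with
      \<open>y\<close>.\<close>
    then obtain z where z: "F z = 0" "z$0 ^ 4 + z$j ^ 4 \<noteq> 0" "g z \<noteq> 0"
      using chart[OF i(1) x(3) q[of j] x(2) i(2) x(4) c(1)] c(2) by blast
    then obtain z' where "F z' = 0" "z'$0 ^ 4 + z'$j ^ 4 \<noteq> 0" "g z' \<noteq> 0" "h z' \<noteq> 0"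
      using chart[OF j(1) x(3) y(3) z y(2) j(2) y(4)] by blast
    then show ?thesis by (intro exI[of _ z']) auto
  qed
  let ?V = "zero_locus {F}"
  have V: "?V \<subseteq> proj_space" by (rule zero_locus_subset)
  have "irreducible_space (subtopology (zariski UNIV) ?V)"
    unfolding irreducible_space_def
  proof (intro conjI allI impI)
    have "c \<noteq> 0" by (auto simp: c_def vec_eq_iff)
    then have "proj_point c \<in> ?V"
      using c(1) by (simp add: proj_point_in_zero_locus[OF F])
    then show "topspace (subtopology (zariski UNIV) ?V) \<noteq> {}"
      using complex_coeff.topspace_subzariski[OF V] by blast
    fix U W
    assume UW: "openin (subtopology (zariski UNIV) ?V) U \<and> openin (subtopology (zariski UNIV) ?V) W \<and>
      U \<noteq> {} \<and> W \<noteq> {}"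
    have point: "\<exists>x f d. x \<noteq> 0 \<and> F x = 0 \<and> f \<in> hpoly UNIV d \<and> f x \<noteq> 0 \<and>
        (\<forall>y. y \<noteq> 0 \<and> f y \<noteq> 0 \<and> F y = 0 \<longrightarrow> proj_point y \<in> U)"
      if U: "openin (subtopology (zariski UNIV) ?V) U" "U \<noteq> {}" for U
    proof -
      obtain P where P: "P \<in> U" using U(2) by blast
      have "U \<subseteq> ?V" by (rule complex_coeff.openin_subzariski_subset[OF V U(1)])
      then obtain x where x: "x \<noteq> 0" "P = proj_point x" "P \<in> ?V"
        using P V subset_proj_spaceE by (metis subsetD)
      obtain f d where "f \<in> hpoly UNIV d" "f x \<noteq> 0"
        "\<And>y. y \<noteq> 0 \<Longrightarrow> f y \<noteq> 0 \<Longrightarrow> proj_point y \<in> ?V \<Longrightarrow> proj_point y \<in> U"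
        by (rule complex_coeff.openin_subzariskiE[OF V U(1) x(1) P[unfolded x(2)]]) (rule that)
      then show ?thesis
        using x by (intro exI[of _ x] exI[of _ f] exI[of _ d]) (simp add: proj_point_in_zero_locus[OF F])
    qed
    obtain x g d where x: "x \<noteq> 0" "F x = 0" "g \<in> hpoly UNIV d" "g x \<noteq> 0"
      "\<forall>y. y \<noteq> 0 \<and> g y \<noteq> 0 \<and> F y = 0 \<longrightarrow> proj_point y \<in> U"
      using point[of U] UW by blast
    obtain y h e where y: "y \<noteq> 0" "F y = 0" "h \<in> hpoly UNIV e" "h y \<noteq> 0"
      "\<forall>y. y \<noteq> 0 \<and> h y \<noteq> 0 \<and> F y = 0 \<longrightarrow> proj_point y \<in> W"
      using point[of W] UW by blast
    obtain z where z: "z \<noteq> 0" "F z = 0" "g z \<noteq> 0" "h z \<noteq> 0"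
      using irr[OF x(1-4) y(1-4)] by blast
    then show "U \<inter> W \<noteq> {}"
      using x(5) y(5) z by blast
  qed
  then show ?thesis
    by (simp add: hypersurface_def proj_subspace_def F_def[abs_def])
qed

section \<open>Real points\<close>

definition of_real_vec :: "real^'n \<Rightarrow> complex^'n" where
  "of_real_vec u = (\<chi> i. of_real (u$i))"

lemma of_real_vec_nth [simp]: "of_real_vec u $ i = of_real (u$i)"
  by (simp add: of_real_vec_def)

lemma of_real_vec_eq_0_iff [simp]: "of_real_vec u = 0 \<longleftrightarrow> u = 0"
  by (simp add: vec_eq_iff)

lemma continuous_on_of_real_vec: "continuous_on S of_real_vec"
  unfolding of_real_vec_def[abs_def] by (intro continuous_intros)

definition real_point :: "real^'n \<Rightarrow> (complex^'n) set" where
  "real_point u = proj_point (of_real_vec u)"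

lemma real_point_scale:
  assumes "c \<noteq> 0"
  shows "real_point (c *\<^sub>R u) = real_point u"
proof -
  have "of_real_vec (c *\<^sub>R u) = of_real c *s of_real_vec u"
    by (simp add: vec_eq_iff)
  then show ?thesis
    using assms by (simp add: real_point_def proj_point_scale)
qed

lemma real_point_eqE:
  assumes "real_point u = real_point v" "u \<noteq> 0"
  obtains c where "c \<noteq> 0" "u = c *\<^sub>R v"
proof -
  obtain c where c: "c \<noteq> 0" "of_real_vec u = c *s of_real_vec v"
    using assms(1) unfolding real_point_def by (rule proj_point_eqE)
  then have eq: "of_real (u$i) = c * of_real (v$i)" for i
    by (simp add: vec_eq_iff)
  \<comment> \<open>Both vectors are real, so the real part of the complex factor already does the
    scaling; it is nonzero because \<open>u\<close> is.\<close>
  have "u$i = Re c * v$i" for i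
    using arg_cong[OF eq, of Re] by simp
  then have "u = Re c *\<^sub>R v"
    by (simp add: vec_eq_iff)
  then show ?thesis
    using that[of "Re c"] assms(2) by auto
qed

lemma real_point_in_zero_locus:
  "F \<in> hpoly k d \<Longrightarrow> u \<noteq> 0 \<Longrightarrow> real_point u \<in> zero_locus {F} \<longleftrightarrow> F (of_real_vec u) = 0"
  unfolding real_point_def by (rule proj_point_in_zero_locus) auto

text \<open>Near a real point a morphism over \<open>\<real>\<close> is given in suitable affine coordinates by fractions
  of real polynomials.\<close>

lemma morphism_real_lift:
  fixes u :: "real^'n" and V :: "(complex^'n) set set" and V' :: "(complex^'m) set set"
  assumes V: "V \<subseteq> proj_space" and V': "V' \<subseteq> proj_space"
    and mor: "morphism (proj_subspace \<real> V) (proj_subspace \<real> V') \<phi>"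
    and u: "u \<noteq> 0" "real_point u \<in> V"
  obtains N and L :: "real^'n \<Rightarrow> real^'m"
  where "open N" "u \<in> N" "continuous_on N L"
    "\<And>v. v \<in> N \<Longrightarrow> real_point v \<in> V \<Longrightarrow> L v \<noteq> 0 \<and> \<phi> (real_point v) = real_point (L v)"
proof -
  have maps: "\<phi> P \<in> V'" if "P \<in> V" for P
    using mor that real_coeff.topspace_subzariski[OF V] real_coeff.topspace_subzariski[OF V']
    by (auto simp: morphism_def proj_subspace_def continuous_map_def simp del: topspace_subtopology)
  obtain y where y: "y \<noteq> 0" "\<phi> (real_point u) = proj_point y"
    using subset_proj_spaceE[OF maps[OF u(2)] V'] by metis
  obtain j where j: "y$j \<noteq> 0"
    using y(1) by (auto simp: vec_eq_iff)
  define x where "x i = (\<lambda>z::complex^'m. z$i)" for i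
  have x: "x i \<in> hpoly \<real> 1" for i
    unfolding x_def by (rule real_coeff.hpoly_coord)
  have x_locus: "proj_point z \<in> zero_locus {x j} \<longleftrightarrow> z$j = 0" if "z \<noteq> 0" for z j
    unfolding proj_point_in_zero_locus[OF x that] by (simp add: x_def)
  \<comment> \<open>The affine chart of the target around the image of \<open>u\<close>. Pulling
    back its coordinate functions \<open>x i / x j\<close> expresses the morphism by real
    forms.\<close>
  define U where "U = V' - zero_locus {x j}"
  have "openin (subtopology (zariski \<real>) V') U"
    unfolding U_def by (rule real_coeff.openin_subzariski_nonvanishing[OF V' x])
  moreover have "hquot (x i) (x j) \<in> regular_fun \<real> V' U" for i
    unfolding U_def by (rule real_coeff.hquot_regular[OF V' x x])
  ultimately have reg: "hquot (x i) (x j) \<circ> \<phi> \<in> regular_fun \<real> V {P \<in> V. \<phi> P \<in> U}" for i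
    using mor real_coeff.topspace_subzariski[OF V]
    by (auto simp: morphism_def proj_subspace_def simp del: topspace_subtopology)
  have uU: "proj_point (of_real_vec u) \<in> {P \<in> V. \<phi> P \<in> U}"
    using u(2) y maps[OF u(2)] j
    by (simp add: U_def real_point_def x_locus)
  have "\<exists>d g h. g \<in> hpoly \<real> d \<and> h \<in> hpoly \<real> d \<and> h (of_real_vec u) \<noteq> 0 \<and>
      (\<forall>z. z \<noteq> 0 \<longrightarrow> h z \<noteq> 0 \<longrightarrow> proj_point z \<in> V \<longrightarrow>
        \<phi> (proj_point z) \<in> U \<and> hquot (x i) (x j) (\<phi> (proj_point z)) = g z / h z)" for i
  proof -
    obtain d g h where "g \<in> hpoly \<real> d" "h \<in> hpoly \<real> d" "h (of_real_vec u) \<noteq> 0"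
      "\<And>z. z \<noteq> 0 \<Longrightarrow> h z \<noteq> 0 \<Longrightarrow> proj_point z \<in> V \<Longrightarrow>
        proj_point z \<in> {P \<in> V. \<phi> P \<in> U} \<and> (hquot (x i) (x j) \<circ> \<phi>) (proj_point z) = g z / h z"
      by (rule real_coeff.regular_funE[OF V reg _ uU]) (use u(1) that in auto)
    then show ?thesis by (intro exI[of _ d] exI[of _ g] exI[of _ h]) simp
  qed
  then obtain d g h where gh: "\<And>i. g i \<in> hpoly \<real> (d i)" "\<And>i. h i \<in> hpoly \<real> (d i)"
      "\<And>i. h i (of_real_vec u) \<noteq> 0"
      "\<And>i z. z \<noteq> 0 \<Longrightarrow> h i z \<noteq> 0 \<Longrightarrow> proj_point z \<in> V \<Longrightarrow>
        \<phi> (proj_point z) \<in> U \<and> hquot (x i) (x j) (\<phi> (proj_point z)) = g i z / h i z"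
    by metis
  have cont: "continuous_on S (\<lambda>v. f (of_real_vec v))" if "f \<in> hpoly \<real> e" for f :: "complex^'n \<Rightarrow> complex" and e S
    using continuous_on_compose[OF continuous_on_of_real_vec continuous_on_hpoly[OF that]]
    by (simp add: o_def)
  have cont: "continuous_on S (\<lambda>v. g i (of_real_vec v))" "continuous_on S (\<lambda>v. h i (of_real_vec v))" for S i
    by (rule cont[OF gh(1)], rule cont[OF gh(2)])
  define N where "N = {v. v \<noteq> 0} \<inter> (\<Inter>i. {v. h i (of_real_vec v) \<noteq> 0})"
  \<comment> \<open>At real vectors the quotients of real forms are real, so \<open>Re\<close>
    leaves their values unchanged and only moves them to type \<open>real\<close>.\<close>
  define L where "L v = (\<chi> i. Re (g i (of_real_vec v) / h i (of_real_vec v)))" for v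
  have "open N"
    unfolding N_def using open_Collect_neq[OF cont(2) continuous_on_const]
    by (intro open_Int open_INT ballI) (auto simp: open_Collect_neq)
  moreover have "u \<in> N"
    using u gh(3) by (auto simp: N_def)
  moreover have "continuous_on N L"
    unfolding L_def by (intro continuous_intros cont) (auto simp: N_def)
  moreover have "L v \<noteq> 0 \<and> \<phi> (real_point v) = real_point (L v)" if v: "v \<in> N" "real_point v \<in> V" for v
  proof -
    have v': "of_real_vec v \<noteq> 0" "h i (of_real_vec v) \<noteq> 0" for i
      using v(1) by (auto simp: N_def)
    note at_v = gh(4)[OF v' v(2)[unfolded real_point_def], folded real_point_def]
    have "\<phi> (real_point v) \<in> V'" by (rule maps[OF v(2)])
    then obtain z where z: "z \<noteq> 0" "\<phi> (real_point v) = proj_point z"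
      using subset_proj_spaceE[OF _ V'] by metis
    then have "z$j \<noteq> 0"
      using at_v[of j] by (simp add: U_def x_locus)
    have "z$i / z$j = of_real (L v $ i)" for i
    proof -
      have "z$i / z$j = g i (of_real_vec v) / h i (of_real_vec v)"
        using at_v[of i] z hquot_proj_point[OF x x, of i j z] by (simp add: x_def)
      moreover have "g i (of_real_vec v) / h i (of_real_vec v) \<in> \<real>"
        by (rule Reals_divide[OF hpoly_real_value[OF gh(1)] hpoly_real_value[OF gh(2)]]) simp_all
      ultimately show ?thesis
        by (simp add: L_def)
    qed
    then have eq: "of_real_vec (L v) = (1 / z$j) *s z"
      by (simp add: vec_eq_iff)
    then have "real_point (L v) = proj_point z"
      using \<open>z$j \<noteq> 0\<close> by (simp add: real_point_def proj_point_scale)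
    moreover have "L v \<noteq> 0"
      using eq \<open>z \<noteq> 0\<close> \<open>z$j \<noteq> 0\<close> of_real_vec_eq_0_iff[of "L v"] by auto
    ultimately show ?thesis using z by simp
  qed
  ultimately show ?thesis by (rule that)
qed

lemma morphism_real_point:
  fixes u :: "real^'n" and V :: "(complex^'n) set set" and V' :: "(complex^'m) set set"
  assumes V: "V \<subseteq> proj_space" and V': "V' \<subseteq> proj_space"
    and mor: "morphism (proj_subspace \<real> V) (proj_subspace \<real> V') \<phi>"
    and u: "u \<noteq> 0" "real_point u \<in> V"
  obtains v :: "real^'m" where "v \<noteq> 0" "real_point v \<in> V'" "\<phi> (real_point u) = real_point v"
proof -
  obtain N L where "u \<in> N"
    "\<And>v. v \<in> N \<Longrightarrow> real_point v \<in> V \<Longrightarrow> L v \<noteq> (0::real^'m) \<and> \<phi> (real_point v) = real_point (L v)"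
    using morphism_real_lift[OF V V' mor u] by metis
  then have "L u \<noteq> 0" "\<phi> (real_point u) = real_point (L u)"
    using u(2) by auto
  moreover have "\<phi> (real_point u) \<in> V'"
    using mor u(2) real_coeff.topspace_subzariski[OF V] real_coeff.topspace_subzariski[OF V']
    by (auto simp: morphism_def proj_subspace_def continuous_map_def simp del: topspace_subtopology)
  ultimately show ?thesis using that[of "L u"] by simp
qed

text \<open>Lets a function of real vectors be evaluated at the image of a morphism, which is a
  class of complex vectors. For scale-invariant functions the chosen representative does not
  matter.\<close>

definition on_real_points :: "(real^'n \<Rightarrow> 'b) \<Rightarrow> (complex^'n) set \<Rightarrow> 'b" where
  "on_real_points \<Theta> P = \<Theta> (SOME u. u \<noteq> 0 \<and> real_point u = P)"

lemma on_real_points: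
  assumes "\<And>c u. c \<noteq> 0 \<Longrightarrow> \<Theta> (c *\<^sub>R u) = \<Theta> u" "u \<noteq> 0"
  shows "on_real_points \<Theta> (real_point u) = \<Theta> u"
proof -
  define v where "v = (SOME v. v \<noteq> 0 \<and> real_point v = real_point u)"
  have "v \<noteq> 0 \<and> real_point v = real_point u"
    unfolding v_def by (rule someI[of _ u]) (use assms(2) in simp)
  then obtain c where "c \<noteq> 0" "v = c *\<^sub>R u"
    by (blast elim: real_point_eqE)
  then show ?thesis
    using assms(1) by (simp add: on_real_points_def flip: v_def)
qed

text \<open>Near each parameter the function is \<open>\<Theta>\<close> after the local lift
  \<open>L\<close> after \<open>e\<close>. This stands in for continuity of the morphism in a
  Euclidean topology on real points: \<open>e\<close> tests the source and \<open>\<Theta>\<close>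
  observes the target.\<close>

lemma continuous_on_morphism_real_points:
  fixes V :: "(complex^'n) set set" and V' :: "(complex^'m) set set"
    and \<Theta> :: "real^'m \<Rightarrow> 'b::topological_space" and e :: "'a::topological_space \<Rightarrow> real^'n"
  assumes V: "V \<subseteq> proj_space" and V': "V' \<subseteq> proj_space"
    and mor: "morphism (proj_subspace \<real> V) (proj_subspace \<real> V') \<phi>"
    and \<Theta>: "\<And>c u. c \<noteq> 0 \<Longrightarrow> \<Theta> (c *\<^sub>R u) = \<Theta> u"
      "continuous_on {u. u \<noteq> 0 \<and> real_point u \<in> V'} \<Theta>"
    and e: "continuous_on T e" "\<And>t. t \<in> T \<Longrightarrow> e t \<noteq> 0" "\<And>t. t \<in> T \<Longrightarrow> real_point (e t) \<in> V"
  shows "continuous_on T (\<lambda>t. on_real_points \<Theta> (\<phi> (real_point (e t))))"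
  unfolding continuous_on_def
proof
  fix t assume t: "t \<in> T"
  obtain N L where NL: "open N" "e t \<in> N" "continuous_on N L"
    "\<And>v. v \<in> N \<Longrightarrow> real_point v \<in> V \<Longrightarrow> L v \<noteq> (0::real^'m) \<and> \<phi> (real_point v) = real_point (L v)"
    using morphism_real_lift[OF V V' mor e(2,3)[OF t]] by metis
  have maps: "\<phi> P \<in> V'" if "P \<in> V" for P
    using mor that real_coeff.topspace_subzariski[OF V] real_coeff.topspace_subzariski[OF V']
    by (auto simp: morphism_def proj_subspace_def continuous_map_def simp del: topspace_subtopology)
  have eq: "on_real_points \<Theta> (\<phi> (real_point (e s))) = \<Theta> (L (e s))"
    and mem: "L (e s) \<in> {u. u \<noteq> 0 \<and> real_point u \<in> V'}"
    if s: "s \<in> T" "e s \<in> N" for s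
    using NL(4)[OF s(2) e(3)[OF s(1)]] maps[OF e(3)[OF s(1)]] by (auto simp: on_real_points[OF \<Theta>(1)])
  have lim: "(e \<longlongrightarrow> e t) (at t within T)"
    using e(1) t unfolding continuous_on_def by blast
  have "eventually (\<lambda>s. e s \<in> N) (at t within T)"
    using topological_tendstoD[OF lim NL(1,2)] .
  moreover have "eventually (\<lambda>s. s \<in> T) (at t within T)"
    by (simp add: eventually_at_filter)
  ultimately have ev: "eventually (\<lambda>s. s \<in> T \<and> e s \<in> N) (at t within T)"
    by eventually_elim simp
  have "((\<lambda>s. L (e s)) \<longlongrightarrow> L (e t)) (at t within T)"
    by (rule continuous_on_tendsto_compose[OF NL(3) lim NL(2)])
      (use ev in \<open>auto elim: eventually_mono\<close>)
  then have "((\<lambda>s. \<Theta> (L (e s))) \<longlongrightarrow> \<Theta> (L (e t))) (at t within T)"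
    by (rule continuous_on_tendsto_compose[OF \<Theta>(2)])
      (use ev mem t NL(2) in \<open>auto elim!: eventually_mono\<close>)
  then have "((\<lambda>s. \<Theta> (L (e s))) \<longlongrightarrow> on_real_points \<Theta> (\<phi> (real_point (e t)))) (at t within T)"
    using eq[OF t NL(2)] by simp
  then show "((\<lambda>s. on_real_points \<Theta> (\<phi> (real_point (e s)))) \<longlongrightarrow>
      on_real_points \<Theta> (\<phi> (real_point (e t)))) (at t within T)"
    by (rule Lim_transform_eventually) (use ev eq in \<open>auto elim!: eventually_mono\<close>)
qed

section \<open>Topological obstructions to isomorphisms\<close>

lemma isomorphic_real_points:
  fixes V :: "(complex^'n) set set" and V' :: "(complex^'m) set set"
  assumes V: "V \<subseteq> proj_space" and V': "V' \<subseteq> proj_space"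
    and iso: "isomorphic (proj_subspace \<real> V) (proj_subspace \<real> V')"
    and u: "u \<noteq> 0" "real_point u \<in> V"
  shows "\<exists>v :: real^'m. v \<noteq> 0 \<and> real_point v \<in> V'"
proof -
  obtain \<phi> where "morphism (proj_subspace \<real> V) (proj_subspace \<real> V') \<phi>"
    using iso unfolding isomorphic_def by (elim exE conjE) (rule that)
  then obtain v :: "real^'m" where "v \<noteq> 0" "real_point v \<in> V'" "\<phi> (real_point u) = real_point v"
    by (rule morphism_real_point[OF V V' _ u])
  then show ?thesis by blast
qed

lemma isomorphic_proj_subspaceE:
  fixes V :: "(complex^'n) set set" and V' :: "(complex^'m) set set"
  assumes V: "V \<subseteq> proj_space" and V': "V' \<subseteq> proj_space"
    and iso: "isomorphic (proj_subspace \<real> V) (proj_subspace \<real> V')"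
  obtains \<phi> \<psi> where "morphism (proj_subspace \<real> V) (proj_subspace \<real> V') \<phi>"
    "morphism (proj_subspace \<real> V') (proj_subspace \<real> V) \<psi>"
    "\<And>Q. Q \<in> V' \<Longrightarrow> \<phi> (\<psi> Q) = Q"
proof -
  obtain \<phi> \<psi> where "morphism (proj_subspace \<real> V) (proj_subspace \<real> V') \<phi>"
    "morphism (proj_subspace \<real> V') (proj_subspace \<real> V) \<psi>"
    and inv: "\<forall>Q\<in>topspace (zar (proj_subspace \<real> V')). \<phi> (\<psi> Q) = Q"
    using iso unfolding isomorphic_def by (elim exE conjE) (rule that)
  moreover have "topspace (zar (proj_subspace \<real> V')) = V'"
    unfolding proj_subspace_def using real_coeff.topspace_subzariski[OF V'] by (simp del: topspace_subtopology)
  ultimately show ?thesis using that by simp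
qed

text \<open>Intermediate values on \<open>T\<close>: the pulled-back function attains every value of
  \<open>\<Theta>\<close> on the real locus of \<open>V'\<close>, since \<open>\<psi>\<close> gives
  real preimages and \<open>e\<close> reaches them all. A change of sign would make it vanish
  somewhere.\<close>

lemma isomorphic_connected_real_points:
  fixes V :: "(complex^'n) set set" and V' :: "(complex^'m) set set"
    and \<Theta> :: "real^'m \<Rightarrow> real" and e :: "'a::topological_space \<Rightarrow> real^'n"
  assumes V: "V \<subseteq> proj_space" and V': "V' \<subseteq> proj_space"
    and iso: "isomorphic (proj_subspace \<real> V) (proj_subspace \<real> V')"
    and e: "connected T" "continuous_on T e" "\<And>t. t \<in> T \<Longrightarrow> e t \<noteq> 0" "\<And>t. t \<in> T \<Longrightarrow> real_point (e t) \<in> V"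
      "\<And>u. u \<noteq> 0 \<Longrightarrow> real_point u \<in> V \<Longrightarrow> \<exists>t\<in>T. real_point (e t) = real_point u"
    and \<Theta>: "\<And>c u. c \<noteq> 0 \<Longrightarrow> \<Theta> (c *\<^sub>R u) = \<Theta> u"
      "continuous_on {u. u \<noteq> 0 \<and> real_point u \<in> V'} \<Theta>"
      "\<And>u. u \<noteq> 0 \<Longrightarrow> real_point u \<in> V' \<Longrightarrow> \<Theta> u \<noteq> 0"
    and v: "v \<noteq> 0" "real_point v \<in> V'" and w: "w \<noteq> 0" "real_point w \<in> V'"
  shows "\<not> (\<Theta> v < 0 \<and> 0 < \<Theta> w)"
proof
  assume neg_pos: "\<Theta> v < 0 \<and> 0 < \<Theta> w"
  obtain \<phi> \<psi> where mor: "morphism (proj_subspace \<real> V) (proj_subspace \<real> V') \<phi>"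
    "morphism (proj_subspace \<real> V') (proj_subspace \<real> V) \<psi>"
    and inv: "\<And>Q. Q \<in> V' \<Longrightarrow> \<phi> (\<psi> Q) = Q"
    by (rule isomorphic_proj_subspaceE[OF V V' iso]) (rule that)
  define f where "f t = on_real_points \<Theta> (\<phi> (real_point (e t)))" for t
  have "continuous_on T f"
    unfolding f_def by (rule continuous_on_morphism_real_points[OF V V' mor(1) \<Theta>(1,2) e(2,3,4)])
  then have conn: "connected (f ` T)"
    using e(1) by (rule connected_continuous_image)
  have attained: "\<Theta> u \<in> f ` T" if u: "u \<noteq> 0" "real_point u \<in> V'" for u
  proof -
    obtain u' where u': "u' \<noteq> 0" "real_point u' \<in> V" "\<psi> (real_point u) = real_point u'"
      by (rule morphism_real_point[OF V' V mor(2) u]) (rule that)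
    then obtain t where t: "t \<in> T" "real_point (e t) = \<psi> (real_point u)"
      using e(5) by metis
    then have "f t = \<Theta> u"
      using inv[OF u(2)] u(1) \<Theta>(1) by (simp add: f_def on_real_points)
    then show ?thesis using t(1) by (metis imageI)
  qed
  have "0 \<in> f ` T"
    using connectedD_interval[OF conn attained[OF v] attained[OF w], of 0] neg_pos by simp
  then obtain t where t: "t \<in> T" "f t = 0" by auto
  obtain u where "u \<noteq> 0" "real_point u \<in> V'" "\<phi> (real_point (e t)) = real_point u"
    by (rule morphism_real_point[OF V V' mor(1) e(3,4)[OF t(1)]]) (rule that)
  then show False
    using t(2) \<Theta>(1,3) by (simp add: f_def on_real_points)
qed

text \<open>Along \<open>cis t\<close> the difference \<open>k (cis t) - 2 * \<i> * t\<close> is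
  continuous with values in the discrete set of periods of \<open>exp\<close>, hence constant. Yet
  one full turn changes it by \<open>- 4 * pi * \<i>\<close>.\<close>

lemma square_no_continuous_log:
  fixes k :: "complex \<Rightarrow> complex"
  assumes "continuous_on (sphere 0 1) k" "\<And>w. w \<in> sphere 0 1 \<Longrightarrow> w\<^sup>2 = exp (k w)"
  shows False
proof -
  define j where "j t = k (cis t) - 2 * \<i> * of_real t" for t
  have "cis ` UNIV \<subseteq> sphere 0 1" by auto
  then have "continuous_on UNIV (\<lambda>t. k (cis t))"
    using continuous_on_compose2[OF assms(1) continuous_on_cis[OF continuous_on_id]] by simp
  then have "continuous_on UNIV j"
    unfolding j_def by (intro continuous_intros)
  have "exp (j t) = 1" for t
  proof -
    have "exp (k (cis t)) = (exp (\<i> * of_real t))\<^sup>2"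
      using assms(2)[of "cis t"] by (simp add: cis_conv_exp)
    also have "\<dots> = exp (2 * \<i> * of_real t)"
      by (simp add: mult.assoc flip: exp_of_nat_mult[of 2])
    finally show ?thesis by (simp add: j_def exp_diff)
  qed
  then have diff: "exp (j t - j s) = 1" for s t by (simp add: exp_diff)
  have "j constant_on UNIV"
  proof (rule continuous_discrete_range_constant[OF connected_UNIV \<open>continuous_on UNIV j\<close>])
    fix s
    have "2 * pi \<le> norm (j t - j s)" if "j t \<noteq> j s" for t
    proof -
      obtain n :: int where n: "Re (j t - j s) = 0" "Im (j t - j s) = of_int (2 * n) * pi"
        using diff[of t s] unfolding exp_eq_1 by blast
      then have "n \<noteq> 0"
        using that by (auto simp: complex_eq_iff)
      then have "1 \<le> \<bar>real_of_int n\<bar>" by linarith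
      then have "2 * pi \<le> \<bar>Im (j t - j s)\<bar>"
        unfolding n(2) by (simp add: abs_mult)
      then show ?thesis
        using abs_Im_le_cmod order_trans by blast
    qed
    then show "\<exists>e>0. \<forall>t. t \<in> UNIV \<and> j t \<noteq> j s \<longrightarrow> e \<le> norm (j t - j s)"
      by (intro exI[of _ "2 * pi"]) auto
  qed
  then have "j 0 = j (2 * pi)"
    unfolding constant_on_def by (elim exE) simp
  then show False
    by (simp add: j_def)
qed

section \<open>The four real quartic surfaces\<close>

definition vec4 :: "'a \<Rightarrow> 'a \<Rightarrow> 'a \<Rightarrow> 'a \<Rightarrow> 'a^4" where
  "vec4 a b c d = (\<chi> i. if i = 0 then a else if i = 1 then b else if i = 2 then c else d)"

lemma vec4_nth [simp]:
  "vec4 a b c d $ 0 = a" "vec4 a b c d $ 1 = b" "vec4 a b c d $ 2 = c" "vec4 a b c d $ 3 = d"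
  by (simp_all add: vec4_def)

lemma vec_eq_iff_4: "(x :: 'a^4) = y \<longleftrightarrow> x$0 = y$0 \<and> x$1 = y$1 \<and> x$2 = y$2 \<and> x$3 = y$3"
  unfolding vec_eq_iff by (rule forall_4')

lemma continuous_on_vec4:
  assumes "continuous_on S f" "continuous_on S g" "continuous_on S h" "continuous_on S k"
  shows "continuous_on S (\<lambda>x. vec4 (f x) (g x) (h x) (k x))"
proof -
  have "\<forall>i. continuous_on S (\<lambda>x. vec4 (f x) (g x) (h x) (k x) $ i)"
    unfolding forall_4' using assms by simp
  then show ?thesis
    using continuous_on_vec_lambda[of S "\<lambda>i x. vec4 (f x) (g x) (h x) (k x) $ i"] by simp
qed

lemma (in coeff_ring) hpoly_vec4:
  assumes "f \<in> hpoly k d" "g \<in> hpoly k d" "h \<in> hpoly k d" "l \<in> hpoly k d"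
  shows "(\<lambda>x::complex^'n. vec4 (f x) (g x) (h x) (l x) $ i) \<in> hpoly k d"
proof -
  have "\<forall>i. (\<lambda>x::complex^'n. vec4 (f x) (g x) (h x) (l x) $ i) \<in> hpoly k d"
    unfolding forall_4' using assms by simp
  then show ?thesis by (rule spec)
qed

section \<open>The four quartic forms and their coefficients\<close>

definition quartic0 :: "complex^4 \<Rightarrow> complex" where
  "quartic0 x = x$0 ^ 4 + x$1 ^ 4 + x$2 ^ 4 + x$3 ^ 4"

definition quartic1 :: "complex^4 \<Rightarrow> complex" where
  "quartic1 x = - (x$0 ^ 4) + x$1 ^ 4 + x$2 ^ 4 + x$3 ^ 4"

definition quartic2 :: "complex^4 \<Rightarrow> complex" where
  "quartic2 x = - (x$0 ^ 4) - x$1 ^ 4 + x$2 ^ 4 + x$3 ^ 4"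

definition quartic3 :: "complex^4 \<Rightarrow> complex" where
  "quartic3 x = x$0 ^ 4 + x$1 ^ 4 + (x$2 + \<i> * x$3) ^ 4 + (x$2 - \<i> * x$3) ^ 4"

text \<open>The last two terms have conjugate coefficients, so the imaginary unit cancels; this form
  shows that the surface is defined over \<open>\<real>\<close> and isolates the one negative
  term.\<close>

lemma quartic3_expand:
  "quartic3 x = x$0 ^ 4 + x$1 ^ 4 + 2 * x$2 ^ 4 - 12 * (x$2 ^ 2 * x$3 ^ 2) + 2 * x$3 ^ 4"
proof -
  have "(x$2 + \<i> * x$3) ^ 4 + (x$2 - \<i> * x$3) ^ 4 =
      2 * x$2 ^ 4 + 12 * \<i>\<^sup>2 * (x$2 ^ 2 * x$3 ^ 2) + 2 * (\<i>\<^sup>2)\<^sup>2 * x$3 ^ 4"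
    by algebra
  then show ?thesis
    by (simp add: quartic3_def)
qed

context coeff_ring
begin

lemma hpoly_quartics:
  "quartic0 \<in> hpoly k 4" "quartic1 \<in> hpoly k 4" "quartic2 \<in> hpoly k 4"
  unfolding quartic0_def[abs_def] quartic1_def[abs_def] quartic2_def[abs_def]
  by (intro hpoly_add hpoly_diff hpoly_uminus hpoly_coord_power)+

lemma of_nat_closed: "of_nat n \<in> k"
  by (induction n) (auto intro: zero_closed one_closed add_closed)

lemma hpoly_quartic3: "quartic3 \<in> hpoly k 4"
proof -
  have "(\<lambda>x::complex^4. x$2 ^ 2 * x$3 ^ 2) \<in> hpoly k (2 + 2)"
    by (intro hpoly_mult hpoly_coord_power)
  then have mixed: "(\<lambda>x::complex^4. x$2 ^ 2 * x$3 ^ 2) \<in> hpoly k 4" by simp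
  have "2 \<in> k" "12 \<in> k"
    using of_nat_closed[of 2] of_nat_closed[of 12] by simp_all
  then show ?thesis
    unfolding quartic3_expand[abs_def]
    by (intro hpoly_add hpoly_diff hpoly_scale hpoly_coord_power mixed)
qed

end

section \<open>Complex changes of coordinates to the Fermat quartic\<close>

lemma quartic0_irreducible: "irreducible_space (zar (hypersurface UNIV quartic0))"
  using fermat_irreducible unfolding quartic0_def[abs_def] .

lemma real_form_linear:
  assumes F: "F \<in> hpoly \<real> 4"
    and L: "\<And>i. (\<lambda>x. L x $ i) \<in> hpoly UNIV 1" and M: "\<And>i. (\<lambda>x. M x $ i) \<in> hpoly UNIV 1"
    and inv: "\<And>x. M (L x) = x" "\<And>y. L (M y) = y" and eq: "\<And>x. quartic0 (L x) = F x"
  shows "real_form (hypersurface \<real> F) (hypersurface UNIV quartic0)"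
  by (rule real_form_hypersurface[OF F complex_coeff.hpoly_quartics(1) quartic0_irreducible
        complex_coeff.isomorphic_hypersurface_linear[OF hpoly_real_imp_complex[OF F]
          complex_coeff.hpoly_quartics(1) L M inv eq]])

text \<open>Over \<open>\<complex>\<close> the coefficient -1 is a fourth power, so it can be
  absorbed into the coordinate.\<close>

lemma real_form_diagonal:
  fixes F :: "complex^4 \<Rightarrow> complex"
  assumes F: "F \<in> hpoly \<real> 4" and nz: "a \<noteq> 0" "b \<noteq> 0"
    and eq: "\<And>x. F x = a ^ 4 * x$0 ^ 4 + b ^ 4 * x$1 ^ 4 + x$2 ^ 4 + x$3 ^ 4"
  shows "real_form (hypersurface \<real> F) (hypersurface UNIV quartic0)"
proof -
  let ?L = "\<lambda>a b x :: complex^4. vec4 (a * x$0) (b * x$1) (x$2) (x$3)"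
  have "(\<lambda>x. ?L a b x $ i) \<in> hpoly UNIV 1" for a b i
    by (intro complex_coeff.hpoly_vec4 complex_coeff.hpoly_scale complex_coeff.hpoly_coord UNIV_I)
  moreover have "?L (inverse a) (inverse b) (?L a b x) = x" "?L a b (?L (inverse a) (inverse b) x) = x" for x
    using nz by (simp_all add: vec_eq_iff_4)
  moreover have "quartic0 (?L a b x) = F x" for x
    by (simp add: quartic0_def eq power_mult_distrib)
  ultimately show ?thesis
    by (intro real_form_linear[OF F, of "?L a b" "?L (inverse a) (inverse b)"])
qed

lemma real_form_quartics:
  "real_form (hypersurface \<real> quartic0) (hypersurface UNIV quartic0)"
  "real_form (hypersurface \<real> quartic1) (hypersurface UNIV quartic0)"
  "real_form (hypersurface \<real> quartic2) (hypersurface UNIV quartic0)"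
  "real_form (hypersurface \<real> quartic3) (hypersurface UNIV quartic0)"
proof -
  obtain w :: complex where w: "w ^ 4 = -1"
    using csqrt_csqrt_power4 by blast
  then have "w \<noteq> 0" by auto
  show "real_form (hypersurface \<real> quartic0) (hypersurface UNIV quartic0)"
    by (rule real_form_diagonal[OF real_coeff.hpoly_quartics(1), of 1 1]) (simp_all add: quartic0_def)
  show "real_form (hypersurface \<real> quartic1) (hypersurface UNIV quartic0)"
    by (rule real_form_diagonal[OF real_coeff.hpoly_quartics(2), of w 1])
      (simp_all add: quartic1_def \<open>w \<noteq> 0\<close> w)
  show "real_form (hypersurface \<real> quartic2) (hypersurface UNIV quartic0)"
    by (rule real_form_diagonal[OF real_coeff.hpoly_quartics(3), of w w])
      (simp_all add: quartic2_def \<open>w \<noteq> 0\<close> w)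
  show "real_form (hypersurface \<real> quartic3) (hypersurface UNIV quartic0)"
  proof -
    let ?L = "\<lambda>x::complex^4. vec4 (x$0) (x$1) (x$2 + \<i> * x$3) (x$2 - \<i> * x$3)"
    \<comment> \<open>Solves \<open>y$2 = x$2 + \<i> * x$3\<close> and
      \<open>y$3 = x$2 - \<i> * x$3\<close> for \<open>x\<close>; the factor \<open>- \<i>/2\<close>
      is \<open>1 / (2 * \<i>)\<close>.\<close>
    let ?M = "\<lambda>y::complex^4. vec4 (y$0) (y$1) (1/2 * (y$2 + y$3)) (- \<i>/2 * (y$2 - y$3))"
    have "(\<lambda>x. ?L x $ i) \<in> hpoly UNIV 1" "(\<lambda>x. ?M x $ i) \<in> hpoly UNIV 1" for i
      by (intro complex_coeff.hpoly_vec4 complex_coeff.hpoly_add complex_coeff.hpoly_diff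
          complex_coeff.hpoly_scale complex_coeff.hpoly_coord UNIV_I)+
    moreover have "?M (?L x) = x" "?L (?M x) = x" for x
      by (simp_all add: vec_eq_iff_4 field_simps)
    moreover have "quartic0 (?L x) = quartic3 x" for x
      by (simp add: quartic0_def quartic3_def)
    ultimately show ?thesis
      by (intro real_form_linear[OF real_coeff.hpoly_quartic3, of ?L ?M])
  qed
qed

section \<open>Real points of the four quartics\<close>

lemma real_quartic_points:
  assumes "u \<noteq> 0"
  shows "real_point u \<in> zero_locus {quartic0} \<longleftrightarrow> u$0 ^ 4 + u$1 ^ 4 + u$2 ^ 4 + u$3 ^ 4 = 0"
    and "real_point u \<in> zero_locus {quartic1} \<longleftrightarrow> u$1 ^ 4 + u$2 ^ 4 + u$3 ^ 4 = u$0 ^ 4"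
    and "real_point u \<in> zero_locus {quartic2} \<longleftrightarrow> u$0 ^ 4 + u$1 ^ 4 = u$2 ^ 4 + u$3 ^ 4"
    and "real_point u \<in> zero_locus {quartic3} \<longleftrightarrow>
      u$0 ^ 4 + u$1 ^ 4 + 2 * u$2 ^ 4 + 2 * u$3 ^ 4 = 12 * (u$2 ^ 2 * u$3 ^ 2)"
proof -
  have "quartic0 (of_real_vec u) = of_real (u$0 ^ 4 + u$1 ^ 4 + u$2 ^ 4 + u$3 ^ 4)"
    by (simp add: quartic0_def)
  then show "real_point u \<in> zero_locus {quartic0} \<longleftrightarrow> u$0 ^ 4 + u$1 ^ 4 + u$2 ^ 4 + u$3 ^ 4 = 0"
    unfolding real_point_in_zero_locus[OF real_coeff.hpoly_quartics(1) assms] by (simp only: of_real_eq_0_iff)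
  have "quartic1 (of_real_vec u) = of_real (u$1 ^ 4 + u$2 ^ 4 + u$3 ^ 4 - u$0 ^ 4)"
    by (simp add: quartic1_def)
  then show "real_point u \<in> zero_locus {quartic1} \<longleftrightarrow> u$1 ^ 4 + u$2 ^ 4 + u$3 ^ 4 = u$0 ^ 4"
    unfolding real_point_in_zero_locus[OF real_coeff.hpoly_quartics(2) assms]
    by (simp only: of_real_eq_0_iff right_minus_eq)
  have "quartic2 (of_real_vec u) = - of_real ((u$0 ^ 4 + u$1 ^ 4) - (u$2 ^ 4 + u$3 ^ 4))"
    by (simp add: quartic2_def)
  then show "real_point u \<in> zero_locus {quartic2} \<longleftrightarrow> u$0 ^ 4 + u$1 ^ 4 = u$2 ^ 4 + u$3 ^ 4"
    unfolding real_point_in_zero_locus[OF real_coeff.hpoly_quartics(3) assms]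
    by (simp only: of_real_eq_0_iff right_minus_eq neg_equal_0_iff_equal)
  have "quartic3 (of_real_vec u) =
      of_real (u$0 ^ 4 + u$1 ^ 4 + 2 * u$2 ^ 4 + 2 * u$3 ^ 4 - 12 * (u$2 ^ 2 * u$3 ^ 2))"
    by (simp add: quartic3_expand)
  then show "real_point u \<in> zero_locus {quartic3} \<longleftrightarrow>
      u$0 ^ 4 + u$1 ^ 4 + 2 * u$2 ^ 4 + 2 * u$3 ^ 4 = 12 * (u$2 ^ 2 * u$3 ^ 2)"
    unfolding real_point_in_zero_locus[OF real_coeff.hpoly_quartic3 assms]
    by (simp only: of_real_eq_0_iff right_minus_eq)
qed

lemma power4_nonneg: "0 \<le> (x::real) ^ 4"
  by simp

lemma power4_add_eq_0: "(x::real) ^ 4 + y ^ 4 = 0 \<longleftrightarrow> x = 0 \<and> y = 0"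
  by (subst add_nonneg_eq_0_iff) simp_all

lemma quartic0_no_real_point: "u \<noteq> 0 \<Longrightarrow> real_point u \<notin> zero_locus {quartic0}"
  using power4_nonneg[of "u$0"] power4_nonneg[of "u$1"] power4_nonneg[of "u$2"] power4_nonneg[of "u$3"]
  by (auto simp: real_quartic_points vec_eq_iff_4 add_nonneg_eq_0_iff)

lemma quartic1_real_nonzero:
  assumes "u \<noteq> 0" "real_point u \<in> zero_locus {quartic1}"
  shows "u$0 \<noteq> 0"
proof
  assume "u$0 = 0"
  then have "u$1 ^ 4 + u$2 ^ 4 + u$3 ^ 4 = 0"
    using assms by (simp add: real_quartic_points)
  then have "u = 0"
    using \<open>u$0 = 0\<close> by (simp add: vec_eq_iff_4 add_nonneg_eq_0_iff)
  then show False using assms(1) by simp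
qed

lemma quartic2_real_nonzero:
  assumes "u \<noteq> 0" "real_point u \<in> zero_locus {quartic2}"
  shows "0 < u$0 ^ 4 + u$1 ^ 4"
proof (rule ccontr)
  assume "\<not> ?thesis"
  moreover have "u$0 ^ 4 + u$1 ^ 4 = u$2 ^ 4 + u$3 ^ 4"
    using assms by (simp add: real_quartic_points)
  ultimately have "u$0 ^ 4 + u$1 ^ 4 = 0" "u$2 ^ 4 + u$3 ^ 4 = 0"
    using power4_nonneg[of "u$0"] power4_nonneg[of "u$1"] by linarith+
  then have "u = 0"
    by (simp add: vec_eq_iff_4 power4_add_eq_0)
  then show False using assms(1) by simp
qed

text \<open>Only the mixed term can balance the nonnegative fourth powers. Hence the sign of
  \<open>u$2 * u$3\<close>, which scaling preserves, is locally constant and separates the real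
  locus.\<close>

lemma quartic3_real_nonzero:
  assumes "u \<noteq> 0" "real_point u \<in> zero_locus {quartic3}"
  shows "u$2 * u$3 \<noteq> 0"
proof
  assume "u$2 * u$3 = 0"
  then have "u$0 ^ 4 + u$1 ^ 4 + 2 * u$2 ^ 4 + 2 * u$3 ^ 4 = 0"
    using assms by (auto simp: real_quartic_points)
  then have "u = 0"
    by (simp add: vec_eq_iff_4 add_nonneg_eq_0_iff)
  then show False using assms(1) by simp
qed

definition root4 :: "real \<Rightarrow> real" where
  "root4 x = sqrt (sqrt x)"

lemma root4_power4: "0 \<le> x \<Longrightarrow> root4 x ^ 4 = x"
  using power_mult[of "root4 x" 2 2] by (simp add: root4_def)

lemma root4_pos: "0 < x \<Longrightarrow> 0 < root4 x"
  by (simp add: root4_def)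

lemma continuous_on_root4: "continuous_on S f \<Longrightarrow> continuous_on S (\<lambda>x. root4 (f x))"
  unfolding root4_def by (intro continuous_intros)

text \<open>The real locus of the second surface is a sphere, parametrised by the punctured space.\<close>

definition sphere_param :: "real \<times> real \<times> real \<Rightarrow> real^4" where
  "sphere_param t = (case t of (a, b, c) \<Rightarrow> vec4 (root4 (a ^ 4 + b ^ 4 + c ^ 4)) a b c)"

text \<open>Affine coordinates of the chart \<open>u$0 \<noteq> 0\<close>, which contains every real
  point of \<open>quartic1\<close>.\<close>

definition sphere_coord :: "real^4 \<Rightarrow> real \<times> real \<times> real" where
  "sphere_coord u = (u$1 / u$0, u$2 / u$0, u$3 / u$0)"

lemma continuous_on_sphere_param: "continuous_on S sphere_param"
  unfolding sphere_param_def case_prod_unfold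
  by (intro continuous_on_vec4 continuous_on_root4 continuous_intros)

lemma sphere_param_nonzero: "t \<noteq> 0 \<Longrightarrow> sphere_param t \<noteq> 0"
  by (auto simp: sphere_param_def vec_eq_iff_4 zero_prod_def split: prod.splits)

lemma sphere_param_point: "t \<noteq> 0 \<Longrightarrow> real_point (sphere_param t) \<in> zero_locus {quartic1}"
  unfolding real_quartic_points(2)[OF sphere_param_nonzero]
  by (simp add: sphere_param_def root4_power4 split: prod.splits)

lemma sphere_coord_scale: "c \<noteq> 0 \<Longrightarrow> sphere_coord (c *\<^sub>R u) = sphere_coord u"
  by (simp add: sphere_coord_def)

lemma sphere_coord_point:
  assumes u: "u \<noteq> 0" "real_point u \<in> zero_locus {quartic1}"
  shows "sphere_coord u \<noteq> 0" "real_point (sphere_param (sphere_coord u)) = real_point u"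
proof -
  have u0: "u$0 \<noteq> 0" by (rule quartic1_real_nonzero[OF u])
  have "(u$1 / u$0) ^ 4 + (u$2 / u$0) ^ 4 + (u$3 / u$0) ^ 4 = 1"
    using u u0 by (simp add: real_quartic_points power_divide flip: add_divide_distrib)
  then have "sphere_param (sphere_coord u) = (1 / u$0) *\<^sub>R u" and "sphere_coord u \<noteq> 0"
    using u0 by (auto simp: sphere_param_def sphere_coord_def vec_eq_iff_4 root4_def zero_prod_def)
  then show "sphere_coord u \<noteq> 0" "real_point (sphere_param (sphere_coord u)) = real_point u"
    using u0 by (simp_all add: real_point_scale)
qed

text \<open>The real locus of the third surface is a torus; \<open>angle\<close> is its projection to
  the real projective line, which is identified with the unit circle.\<close>

definition torus_param :: "complex \<times> complex \<Rightarrow> real^4" where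
  "torus_param t = (case t of (z, w) \<Rightarrow>
     vec4 (Re z / root4 (Re z ^ 4 + Im z ^ 4)) (Im z / root4 (Re z ^ 4 + Im z ^ 4))
       (Re w / root4 (Re w ^ 4 + Im w ^ 4)) (Im w / root4 (Re w ^ 4 + Im w ^ 4)))"

definition angle :: "real^4 \<Rightarrow> complex" where
  "angle u = (sgn (Complex (u$0) (u$1)))\<^sup>2"

lemma complex_power4_pos: "z \<noteq> 0 \<Longrightarrow> 0 < Re z ^ 4 + Im z ^ 4"
  using power4_nonneg[of "Re z"] power4_nonneg[of "Im z"] power4_add_eq_0[of "Re z" "Im z"]
  by (auto simp: complex_eq_iff less_le)

lemma torus_param_nonzero: "z \<noteq> 0 \<Longrightarrow> torus_param (z, w) \<noteq> 0"
proof
  assume z: "z \<noteq> 0" and "torus_param (z, w) = 0"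
  then have "Re z / root4 (Re z ^ 4 + Im z ^ 4) = 0" "Im z / root4 (Re z ^ 4 + Im z ^ 4) = 0"
    by (simp_all only: torus_param_def vec_eq_iff_4 prod.case vec4_nth zero_index)
  then show False
    using z root4_pos[OF complex_power4_pos[OF z]] by (auto simp: complex_eq_iff)
qed

text \<open>Each pair is divided by its quartic norm, so both sides of the equation are 1.\<close>

lemma torus_param_point:
  assumes "z \<noteq> 0" "w \<noteq> 0"
  shows "real_point (torus_param (z, w)) \<in> zero_locus {quartic2}"
proof -
  have "(Re z / root4 (Re z ^ 4 + Im z ^ 4)) ^ 4 + (Im z / root4 (Re z ^ 4 + Im z ^ 4)) ^ 4 = 1"
    if "z \<noteq> 0" for z
    using complex_power4_pos[OF that] by (simp add: power_divide root4_power4 flip: add_divide_distrib)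
  then show ?thesis
    unfolding real_quartic_points(3)[OF torus_param_nonzero[OF assms(1)]]
    using assms by (simp add: torus_param_def)
qed

lemma continuous_on_torus_param: "continuous_on ((- {0}) \<times> (- {0})) torus_param"
proof -
  have "root4 (Re z ^ 4 + Im z ^ 4) \<noteq> 0" if "z \<noteq> 0" for z
    using root4_pos[OF complex_power4_pos[OF that]] by simp
  then show ?thesis
    unfolding torus_param_def case_prod_unfold
    by (intro continuous_on_vec4 continuous_on_divide continuous_on_root4 continuous_intros) auto
qed

text \<open>On the real locus both pairs have the same quartic norm \<open>r\<close>, so
  \<open>torus_param\<close> rescales the whole vector by \<open>1 / r\<close>.\<close>

lemma torus_param_surj:
  assumes u: "u \<noteq> 0" "real_point u \<in> zero_locus {quartic2}"
  shows "\<exists>t\<in>(- {0}) \<times> (- {0}). real_point (torus_param t) = real_point u"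
proof -
  define r where "r = root4 (u$0 ^ 4 + u$1 ^ 4)"
  have pos: "0 < u$0 ^ 4 + u$1 ^ 4" by (rule quartic2_real_nonzero[OF u])
  have eq: "u$2 ^ 4 + u$3 ^ 4 = u$0 ^ 4 + u$1 ^ 4"
    using u by (simp add: real_quartic_points)
  have "r \<noteq> 0" using root4_pos[OF pos] by (simp add: r_def)
  let ?t = "(Complex (u$0) (u$1), Complex (u$2) (u$3))"
  have "torus_param ?t = (1 / r) *\<^sub>R u"
    by (simp add: torus_param_def vec_eq_iff_4 eq flip: r_def)
  moreover have "?t \<in> (- {0}) \<times> (- {0})"
    using pos pos[folded eq] by (auto simp: complex_eq_iff)
  ultimately show ?thesis
    using \<open>r \<noteq> 0\<close> by (intro bexI[of _ ?t]) (simp_all add: real_point_scale)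
qed

lemma quartic2_real_Complex_nonzero:
  assumes "u \<noteq> 0" "real_point u \<in> zero_locus {quartic2}"
  shows "Complex (u$0) (u$1) \<noteq> 0"
  using quartic2_real_nonzero[OF assms] by (auto simp: complex_eq_iff)

text \<open>\<open>sgn\<close> removes the size of the factor and squaring removes its sign.\<close>

lemma angle_scale: "c \<noteq> 0 \<Longrightarrow> angle (c *\<^sub>R u) = angle u"
proof -
  assume "c \<noteq> 0"
  have "Complex ((c *\<^sub>R u)$0) ((c *\<^sub>R u)$1) = c *\<^sub>R Complex (u$0) (u$1)"
    by (simp add: complex_eq_iff)
  moreover have "(sgn c *\<^sub>R z)\<^sup>2 = z\<^sup>2" for z :: complex
    using \<open>c \<noteq> 0\<close> by (auto simp: sgn_real_def)
  ultimately show ?thesis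
    by (simp only: angle_def sgn_scaleR)
qed

lemma continuous_on_angle:
  "continuous_on {u. u \<noteq> 0 \<and> real_point u \<in> zero_locus {quartic2}} angle"
  unfolding angle_def sgn_div_norm Complex_eq
  using quartic2_real_Complex_nonzero
  by (intro continuous_intros) (auto simp: Complex_eq)

section \<open>Pairwise non-isomorphism over the reals\<close>

lemma not_isomorphic_quartic1_quartic2:
  "\<not> isomorphic (hypersurface \<real> quartic1) (hypersurface \<real> quartic2)"
proof
  let ?V1 = "zero_locus {quartic1}" and ?V2 = "zero_locus {quartic2}"
  assume "isomorphic (hypersurface \<real> quartic1) (hypersurface \<real> quartic2)"
  then have iso: "isomorphic (proj_subspace \<real> ?V1) (proj_subspace \<real> ?V2)"
    by (simp only: hypersurface_def)
  note V = zero_locus_subset[of "{quartic1}"] zero_locus_subset[of "{quartic2}"]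
  obtain \<phi> \<psi> where mor: "morphism (proj_subspace \<real> ?V1) (proj_subspace \<real> ?V2) \<phi>"
    "morphism (proj_subspace \<real> ?V2) (proj_subspace \<real> ?V1) \<psi>"
    and inv: "\<And>Q. Q \<in> ?V2 \<Longrightarrow> \<phi> (\<psi> Q) = Q"
    by (rule isomorphic_proj_subspaceE[OF V iso]) (rule that)
  \<comment> \<open>The circle-valued map of the torus, transported to the punctured space that
    parametrises the sphere. That space is simply connected, so \<open>f\<close> gets a continuous
    logarithm.\<close>
  define f where "f t = on_real_points angle (\<phi> (real_point (sphere_param t)))" for t
  have "continuous_on (- {0}) f"
    unfolding f_def
    by (rule continuous_on_morphism_real_points[OF V mor(1) angle_scale continuous_on_angle
          continuous_on_sphere_param]) (simp_all add: sphere_param_nonzero sphere_param_point)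
  moreover have "f t \<noteq> 0" if "t \<in> - {0}" for t
  proof -
    have t: "sphere_param t \<noteq> 0" "real_point (sphere_param t) \<in> ?V1"
      using that by (simp_all add: sphere_param_nonzero sphere_param_point)
    obtain v where v: "v \<noteq> 0" "real_point v \<in> ?V2" "\<phi> (real_point (sphere_param t)) = real_point v"
      by (rule morphism_real_point[OF V mor(1) t]) (rule that)
    then show ?thesis
      using quartic2_real_Complex_nonzero[OF v(1,2)]
      by (simp add: f_def on_real_points[OF angle_scale] angle_def sgn_zero_iff)
  qed
  moreover have "simply_connected (- {0 :: real \<times> real \<times> real})"
    by (rule simply_connected_punctured_universe) simp
  moreover have "locally path_connected (- {0 :: real \<times> real \<times> real})"
    by (rule open_imp_locally_path_connected) (simp add: open_Compl)
  ultimately obtain k where k: "continuous_on (- {0}) k" "\<And>t. t \<in> - {0} \<Longrightarrow> f t = exp (k t)"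
    using continuous_logarithm_on_simply_connected[of "- {0}" f] by metis
  \<comment> \<open>A loop on which both pairs equal \<open>w\<close>, so that the equation of
    \<open>quartic2\<close> holds trivially and \<open>angle\<close> is \<open>w\<^sup>2\<close>.
    The map \<open>b\<close> carries it through \<open>\<psi>\<close> to the parameters of the
    sphere.\<close>
  define e where "e w = vec4 (Re w) (Im w) (Re w) (Im w)" for w
  define b where "b w = on_real_points sphere_coord (\<psi> (real_point (e w)))" for w
  have e: "e w \<noteq> 0" "real_point (e w) \<in> ?V2" if "w \<in> sphere 0 1" for w
  proof -
    have "w \<noteq> 0" using that by auto
    then show "e w \<noteq> 0"
      by (auto simp: e_def vec_eq_iff_4 complex_eq_iff)
    then show "real_point (e w) \<in> ?V2"
      by (simp add: real_quartic_points) (simp add: e_def)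
  qed
  have "continuous_on {u. u \<noteq> 0 \<and> real_point u \<in> ?V1} sphere_coord"
    unfolding sphere_coord_def by (intro continuous_intros) (auto dest: quartic1_real_nonzero)
  moreover have "continuous_on (sphere 0 1) e"
    unfolding e_def by (intro continuous_on_vec4 continuous_intros)
  ultimately have cont_b: "continuous_on (sphere 0 1) b"
    unfolding b_def
    by (intro continuous_on_morphism_real_points[OF V(2,1) mor(2) sphere_coord_scale] e)
  have b: "b w \<noteq> 0" "f (b w) = w\<^sup>2" if w: "w \<in> sphere 0 1" for w
  proof -
    obtain v where v: "v \<noteq> 0" "real_point v \<in> ?V1" "\<psi> (real_point (e w)) = real_point v"
      by (rule morphism_real_point[OF V(2,1) mor(2) e[OF w]]) (rule that)
    then have bw: "b w = sphere_coord v"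
      by (simp add: b_def on_real_points[OF sphere_coord_scale])
    then show "b w \<noteq> 0"
      using sphere_coord_point(1)[OF v(1,2)] by simp
    have "f (b w) = on_real_points angle (\<phi> (\<psi> (real_point (e w))))"
      using sphere_coord_point(2)[OF v(1,2)] by (simp add: f_def bw v(3))
    also have "\<dots> = angle (e w)"
      by (simp add: inv[OF e(2)[OF w]] on_real_points[OF angle_scale e(1)[OF w]])
    also have "\<dots> = w\<^sup>2"
      using w by (simp add: angle_def e_def sgn_eq)
    finally show "f (b w) = w\<^sup>2" .
  qed
  have "continuous_on (sphere 0 1) (\<lambda>w. k (b w))"
    by (rule continuous_on_compose2[OF k(1) cont_b]) (use b(1) in auto)
  then show False
    by (rule square_no_continuous_log) (use b k(2) in auto)
qed

lemma not_isomorphic_quartic3: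
  fixes e :: "'a::topological_space \<Rightarrow> real^4"
  assumes e: "connected T" "continuous_on T e" "\<And>t. t \<in> T \<Longrightarrow> e t \<noteq> 0"
      "\<And>t. t \<in> T \<Longrightarrow> real_point (e t) \<in> zero_locus {F}"
      "\<And>u. u \<noteq> 0 \<Longrightarrow> real_point u \<in> zero_locus {F} \<Longrightarrow> \<exists>t\<in>T. real_point (e t) = real_point u"
  shows "\<not> isomorphic (hypersurface \<real> F) (hypersurface \<real> quartic3)"
proof
  assume "isomorphic (hypersurface \<real> F) (hypersurface \<real> quartic3)"
  then have iso: "isomorphic (proj_subspace \<real> (zero_locus {F})) (proj_subspace \<real> (zero_locus {quartic3}))"
    by (simp only: hypersurface_def)
  let ?\<Theta> = "\<lambda>u::real^4. sgn (u$2 * u$3)"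
  \<comment> \<open>For \<open>s = 1\<close> and \<open>s = -1\<close> the equation reads
    \<open>4 + 4 + 2 + 2 = 12\<close>, and \<open>u$2 * u$3\<close> takes both signs.\<close>
  define v where "v s = vec4 (sqrt 2) (sqrt 2) 1 s" for s
  have v: "v s \<noteq> 0" "real_point (v s) \<in> zero_locus {quartic3}" if "s\<^sup>2 = 1" for s
  proof -
    show "v s \<noteq> 0" by (simp add: v_def vec_eq_iff_4)
    moreover have "sqrt 2 ^ 4 = (4::real)" "s ^ 4 = 1"
      using power_mult[of "sqrt 2" 2 2] power_mult[of s 2 2] that by simp_all
    ultimately show "real_point (v s) \<in> zero_locus {quartic3}"
      using that by (simp add: real_quartic_points) (simp add: v_def)
  qed
  have "\<not> (?\<Theta> (v (-1)) < 0 \<and> 0 < ?\<Theta> (v 1))"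
  proof (rule isomorphic_connected_real_points[OF zero_locus_subset zero_locus_subset iso e])
    show "?\<Theta> (c *\<^sub>R u) = ?\<Theta> u" if "c \<noteq> 0" for c u
      using that by (simp add: sgn_mult mult_ac)
    show "continuous_on {u. u \<noteq> 0 \<and> real_point u \<in> zero_locus {quartic3}} ?\<Theta>"
      unfolding sgn_div_norm by (intro continuous_intros) (auto dest: quartic3_real_nonzero)
    show "?\<Theta> u \<noteq> 0" if "u \<noteq> 0" "real_point u \<in> zero_locus {quartic3}" for u
      using quartic3_real_nonzero[OF that] by (simp add: sgn_zero_iff)
  qed (use v in auto)
  then show False by (simp add: v_def)
qed

lemma not_isomorphic_quartic1_quartic3:
  "\<not> isomorphic (hypersurface \<real> quartic1) (hypersurface \<real> quartic3)"
proof (rule not_isomorphic_quartic3)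
  show "connected (- {0 :: real \<times> real \<times> real})"
    by (rule connected_punctured_universe) simp
  show "continuous_on (- {0}) sphere_param"
    by (rule continuous_on_sphere_param)
  show "\<exists>t\<in>- {0}. real_point (sphere_param t) = real_point u"
    if "u \<noteq> 0" "real_point u \<in> zero_locus {quartic1}" for u
    using sphere_coord_point[OF that] by auto
qed (simp_all add: sphere_param_nonzero sphere_param_point)

lemma not_isomorphic_quartic2_quartic3:
  "\<not> isomorphic (hypersurface \<real> quartic2) (hypersurface \<real> quartic3)"
proof (rule not_isomorphic_quartic3[OF _ continuous_on_torus_param _ _ torus_param_surj])
  show "connected ((- {0 :: complex}) \<times> (- {0 :: complex}))"
    by (intro connected_Times connected_punctured_universe) simp_all
  show "torus_param t \<noteq> 0" "real_point (torus_param t) \<in> zero_locus {quartic2}"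
    if "t \<in> (- {0}) \<times> (- {0})" for t
    using that torus_param_nonzero torus_param_point by (cases t; simp)+
qed

text \<open>An isomorphism over \<open>\<real>\<close> would carry the real point \<open>u\<close>
  to a real point of the Fermat quartic, which has none.\<close>

lemma not_isomorphic_quartic0:
  assumes "u \<noteq> 0" "real_point u \<in> zero_locus {F}"
  shows "\<not> isomorphic (hypersurface \<real> quartic0) (hypersurface \<real> F)"
  using isomorphic_real_points[OF zero_locus_subset zero_locus_subset _ assms, of "{quartic0}"]
    quartic0_no_real_point isomorphic_sym
  unfolding hypersurface_def by blast

lemma not_isomorphic_quartic0_others:
  "\<not> isomorphic (hypersurface \<real> quartic0) (hypersurface \<real> quartic1)"
  "\<not> isomorphic (hypersurface \<real> quartic0) (hypersurface \<real> quartic2)"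
  "\<not> isomorphic (hypersurface \<real> quartic0) (hypersurface \<real> quartic3)"
proof -
  \<comment> \<open>Real points of the other three surfaces, in order: \<open>-1 + 1 = 0\<close>,
    \<open>1 = 1\<close>, and \<open>4 + 4 + 2 + 2 = 12\<close>.\<close>
  have nz: "vec4 1 1 0 0 \<noteq> (0 :: real^4)" "vec4 1 0 1 0 \<noteq> (0 :: real^4)"
    "vec4 (sqrt 2) (sqrt 2) 1 1 \<noteq> (0 :: real^4)"
    by (simp_all add: vec_eq_iff_4)
  show "\<not> isomorphic (hypersurface \<real> quartic0) (hypersurface \<real> quartic1)"
    by (rule not_isomorphic_quartic0[OF nz(1)]) (use nz in \<open>simp add: real_quartic_points\<close>)
  show "\<not> isomorphic (hypersurface \<real> quartic0) (hypersurface \<real> quartic2)"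
    by (rule not_isomorphic_quartic0[OF nz(2)]) (use nz in \<open>simp add: real_quartic_points\<close>)
  have "sqrt 2 ^ 4 = (4::real)"
    using power_mult[of "sqrt 2" 2 2] by simp
  then show "\<not> isomorphic (hypersurface \<real> quartic0) (hypersurface \<real> quartic3)"
    by (intro not_isomorphic_quartic0[OF nz(3)]) (use nz in \<open>simp add: real_quartic_points\<close>)
qed

theorem mainTheorem6:
  fixes F :: "(complex ^ 4) set fspace" and Y :: "(complex ^ 4) set fspace list"
  defines "F \<equiv> hypersurface UNIV (\<lambda>x. x$0 ^ 4 + x$1 ^ 4 + x$2 ^ 4 + x$3 ^ 4)"
    and "Y \<equiv>
      [hypersurface \<real> (\<lambda>x. x$0 ^ 4 + x$1 ^ 4 + x$2 ^ 4 + x$3 ^ 4),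
       hypersurface \<real> (\<lambda>x. - (x$0 ^ 4) + x$1 ^ 4 + x$2 ^ 4 + x$3 ^ 4),
       hypersurface \<real> (\<lambda>x. - (x$0 ^ 4) - x$1 ^ 4 + x$2 ^ 4 + x$3 ^ 4),
       hypersurface \<real> (\<lambda>x. x$0 ^ 4 + x$1 ^ 4 + (x$2 + \<i> * x$3) ^ 4 + (x$2 - \<i> * x$3) ^ 4)]"
  shows "(\<forall>i < 4. real_form (Y ! i) F) \<and>
         (\<forall>i < 4. \<forall>j < 4. i \<noteq> j \<longrightarrow> \<not> isomorphic (Y ! i) (Y ! j))"
proof -
  have F: "F = hypersurface UNIV quartic0"
    by (simp add: F_def quartic0_def[abs_def])
  have "Y = [hypersurface \<real> quartic0, hypersurface \<real> quartic1, hypersurface \<real> quartic2, hypersurface \<real> quartic3]"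
    by (simp add: Y_def quartic0_def[abs_def] quartic1_def[abs_def] quartic2_def[abs_def] quartic3_def[abs_def])
  then have Y: "Y ! 0 = hypersurface \<real> quartic0" "Y ! 1 = hypersurface \<real> quartic1"
      "Y ! 2 = hypersurface \<real> quartic2" "Y ! 3 = hypersurface \<real> quartic3"
    by (simp_all add: eval_nat_numeral)
  have all_less_4: "(\<forall>i<4. P i) \<longleftrightarrow> P 0 \<and> P 1 \<and> P 2 \<and> P 3" for P :: "nat \<Rightarrow> bool"
    by (auto simp: eval_nat_numeral less_Suc_eq)
  note not_iso = not_isomorphic_quartic0_others not_isomorphic_quartic1_quartic2
    not_isomorphic_quartic1_quartic3 not_isomorphic_quartic2_quartic3
  \<comment> \<open>The theorem ranges over ordered pairs; symmetry reduces these to the six cases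
    in \<open>not_iso\<close>.\<close>
  have not_isoI: "\<not> isomorphic X X' \<and> \<not> isomorphic X' X" if "\<not> isomorphic X X'"
    for X X' :: "(complex^4) set fspace"
    using that isomorphic_sym by blast
  show ?thesis
    unfolding all_less_4 Y F
    using real_form_quartics not_iso[THEN not_isoI] by simp
qed

end
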